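(* Consider a barotropic fluid in Minkowski space, given by a pressure law $p=\tilde p(\theta)$, $\theta>0$, satisfying the strict causality assumption stated in the context, with viscosity and without heat conduction, i.e. with coefficients $\eta>0$, $\zeta>0$ and $\chi=0$. Assume that the acoustic mode is genuinely nonlinear, i.e. that for all admissible energy densities $\rho$, $$(\rho+\hat p(\rho))\,\hat p''(\rho)+2\,(1-\hat p'(\rho))\,\hat p'(\rho)>0 .$$ Then every Lax shock $(\psi^-,\psi^+,\xi)$ of the relativistic Euler equations $\partial_\beta T^{\alpha\beta}=0$ has a dissipation profile with respect to $\Delta T_\Box$. That is, there is a smooth map $\hat\psi$ from $\mathbb R$ to the state space such that $$-\xi_\beta\,\Delta T_\Box^{\alpha\beta}[\hat\psi,\hat\psi']=\xi_\beta T^{\alpha\beta}(\hat\psi)-q^\alpha\quad(\alpha=0,1,2,3),\qquad q^\alpha:=\xi_\beta T^{\alpha\beta}(\psi^-)=\xi_\beta T^{\alpha\beta}(\psi^+),$$ on $\mathbb R$, with $\hat\psi(-\infty)=\psi^-$ and $\hat\psi(+\infty)=\psi^+$.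
   Context: Conventions. The metric is $g^{\alpha\beta}=\mathrm{diag}(-1,1,1,1)$; indices run over $0,1,2,3$ and are raised and lowered with $g$; repeated indices are summed. States. The state space is the set of future-directed timelike 4-vectors $\psi^\alpha$ ($\psi^0>0$, $\psi_\alpha\psi^\alpha<0$). The temperature is $\theta=(-\psi_\alpha\psi^\alpha)^{-1/2}>0$, the 4-velocity is $U^\alpha=\theta\psi^\alpha$ (so $U_\alpha U^\alpha=-1$), and $\Pi^{\alpha\beta}=g^{\alpha\beta}+U^\alpha U^\beta$. Fluid. The fluid is specified by a smooth function $\tilde p:(0,\infty)\to\mathbb R$ with $p=\tilde p(\theta)$. The ideal energy-momentum tensor is $$T^{\alpha\beta}(\psi)=\frac{\partial(\tilde p(\theta)\psi^\beta)}{\partial\psi_\alpha}=\theta^3\tilde p'(\theta)\psi^\alpha\psi^\beta+\tilde p(\theta)g^{\alpha\beta}.$$ Strict causality assumption: for every state $\psi$ and every nonzero future-directed non-spacelike $T$ (timelike or null), the symmetric matrix $\left(\frac{\partial^2(\tilde p(\theta)\psi^\beta)}{\partial\psi_\alpha\partial\psi_\gamma}T_\beta\right)_{\alpha,\gamma=0,\dots,3}$ is negative definite. The energy density is $\rho=\theta\tilde p'(\theta)-\tilde p(\theta)$. The pressure as a function of $\rho$ is written $p=\hat p(\rho)$, and the speed of sound $c_s$ is given by $c_s^2=\hat p'(\rho)$, with $0<c_s<1$. Admissible energy densities are the values of $\rho$ attained for $\theta\in(0,\infty)$. Dissipation tensor. For coefficients $\eta$ (shear viscosity), $\zeta$ (bulk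 viscosity), $\chi$ (thermal conductivity), which are smooth functions of the state, the dissipation tensor $\Delta T_\Box^{\alpha\beta}$ is defined by $$\begin{aligned}-\Delta T^{\alpha\beta}_\Box=\;&\eta\,\Pi^{\alpha\gamma}\Pi^{\beta\delta}\Big[\tfrac{\partial U_\gamma}{\partial x^\delta}+\tfrac{\partial U_\delta}{\partial x^\gamma}-\tfrac23 g_{\gamma\delta}\tfrac{\partial U^\epsilon}{\partial x^\epsilon}\Big]+\check\zeta\,\Pi^{\alpha\beta}\tfrac{\partial U^\gamma}{\partial x^\gamma}\\&+\sigma\Big[U^\alpha U^\beta\tfrac{\partial U^\gamma}{\partial x^\gamma}-(\Pi^{\alpha\gamma}U^\beta+\Pi^{\beta\gamma}U^\alpha)U^\delta\tfrac{\partial U_\gamma}{\partial x^\delta}\Big]\\&+\chi\Big[U^\alpha\tfrac{\partial\theta}{\partial x_\beta}+U^\beta\tfrac{\partial\theta}{\partial x_\alpha}-g^{\alpha\beta}U^\gamma\tfrac{\partial\theta}{\partial x^\gamma}\Big],\end{aligned}$$ $$\sigma=\frac{\tfrac43\eta+\zeta}{1-c_s^2}-c_s^2\chi\theta,\qquad \check\zeta=\zeta+c_s^2\sigma-c_s^2(1-c_s^2)\chi\theta.$$ For a function $\hat\psi$ of the single variable $s=x^\beta\xi_\beta$, the expression $\Delta T_\Box^{\alpha\beta}[\hat\psi,\hat\psi']$ denotes the dissipation tensor $\Delta T_\Box^{\alpha\beta}$ evaluated with $U=\hat\theta\hat\psi$, $\theta=\hat\theta=(-\hat\psi_\alpha\hat\psi^\alpha)^{-1/2}$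 and $\partial/\partial x^\delta$ replaced by $\xi_\delta\,d/ds$. Shocks. A shock is a triple $(\psi^-,\psi^+,\xi)$ of two distinct states and a spacelike unit covector $\xi$ satisfying the Rankine-Hugoniot conditions $\xi_\beta T^{\alpha\beta}(\psi^-)=\xi_\beta T^{\alpha\beta}(\psi^+)$, $\alpha=0,\dots,3$. It represents the discontinuous Euler solution equal to $\psi^-$ for $x^\beta\xi_\beta<0$ and $\psi^+$ for $x^\beta\xi_\beta>0$. In an inertial frame in which $\xi=(0,1,0,0)$, the characteristic speeds at a state $\psi$ are the four real roots $\lambda_1<\lambda_2=\lambda_3<\lambda_4$, counted with multiplicity, of $\det\left(\frac{\partial T^{\alpha1}}{\partial\psi_\gamma}-\lambda\frac{\partial T^{\alpha0}}{\partial\psi_\gamma}\right)=0$; here $\lambda_1,\lambda_4$ are the acoustic speeds. The shock is a Lax shock if either all speeds are positive at $\psi^-$ while $\lambda_1(\psi^+)<0<\lambda_2(\psi^+)$, or all speeds are negative at $\psi^+$ while $\lambda_3(\psi^-)<0<\lambda_4(\psi^-)$. *)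

theory Defs
  imports "HOL-Analysis.Analysis" "HOL-Computational_Algebra.Polynomial"
begin

section \<open>Minkowski space\<close>

text \<open>
  Vectors and covectors are both elements of \<open>real^4\<close>, given by their contravariant or covariant
  components respectively. The index type \<open>4\<close> has the elements \<open>0, 1, 2, 3\<close>; index \<open>0\<close> is time.
  The matrix \<open>mink\<close> is the metric with upper as well as with lower indices, so \<open>mink *v _\<close>
  both raises and lowers an index.
\<close>

definition mink :: "real^4^4" where
  "mink = (\<chi> \<alpha> \<beta>. if \<alpha> = \<beta> then (if \<alpha> = 0 then - 1 else 1) else 0)"

definition mprod :: "real^4 \<Rightarrow> real^4 \<Rightarrow> real" where
  "mprod x y = (\<Sum>\<alpha>\<in>UNIV. \<Sum>\<beta>\<in>UNIV. mink $ \<alpha> $ \<beta> * x $ \<alpha> * y $ \<beta>)"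

lemma index_cases: "(\<alpha>::4) = 0 \<or> \<alpha> = 1 \<or> \<alpha> = 2 \<or> \<alpha> = 3"
proof -
  have "(4::4) = 0"
    by simp
  then show ?thesis
    using exhaust_4[of \<alpha>] by metis
qed

lemma mprod_expand:
  "mprod x y = - x $ 0 * y $ 0 + x $ 1 * y $ 1 + x $ 2 * y $ 2 + x $ 3 * y $ 3"
proof -
  have U: "UNIV = {0, 1, 2, 3 :: 4}"
    using index_cases by blast
  show ?thesis
    unfolding mprod_def U by (simp add: mink_def)
qed

text \<open>Change of coordinates \<open>x \<mapsto> L *v x\<close> between inertial frames with the same time orientation.\<close>

definition orthochronous :: "real^4^4 \<Rightarrow> bool" where
  "orthochronous L \<longleftrightarrow> transpose L ** mink ** L = mink \<and> L $ 0 $ 0 > 0"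

section \<open>Calculus\<close>

fun Ck_on :: "nat \<Rightarrow> 'a set \<Rightarrow> ('a::real_normed_vector \<Rightarrow> 'b::real_normed_vector) \<Rightarrow> bool" where
  "Ck_on 0 S f \<longleftrightarrow> continuous_on S f"
| "Ck_on (Suc k) S f \<longleftrightarrow> (\<forall>x\<in>S. f differentiable (at x)) \<and>
     (\<forall>v. Ck_on k S (\<lambda>x. frechet_derivative f (at x) v))"

text \<open>To be used for open \<open>S\<close> in a finite-dimensional space only.\<close>

definition smooth_on :: "'a set \<Rightarrow> ('a::real_normed_vector \<Rightarrow> 'b::real_normed_vector) \<Rightarrow> bool" where
  "smooth_on S f \<longleftrightarrow> (\<forall>k. Ck_on k S f)"

text \<open>
  The partial derivative \<open>\<partial>f/\<partial>\<psi>\<^sub>\<alpha>\<close> with respect to a covariant component: \<open>\<psi>\<^sub>\<alpha>\<close> is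
  changed to \<open>\<psi>\<^sub>\<alpha> + h\<close>, hence \<open>\<psi>\<close> by \<open>h\<close> times the vector obtained by raising the index of
  the \<open>\<alpha>\<close>-th unit covector.
\<close>

definition pd_lower :: "4 \<Rightarrow> (real^4 \<Rightarrow> real) \<Rightarrow> real^4 \<Rightarrow> real" where
  "pd_lower \<alpha> f \<psi> = deriv (\<lambda>h. f (\<psi> + h *\<^sub>R (mink *v axis \<alpha> 1))) 0"

definition negative_definite :: "real^'n^'n \<Rightarrow> bool" where
  "negative_definite A \<longleftrightarrow> (\<forall>v. v \<noteq> 0 \<longrightarrow> v \<bullet> (A *v v) < 0)"

section \<open>The fluid\<close>

definition states :: "(real^4) set" where
  "states = {\<psi>. \<psi> $ 0 > 0 \<and> mprod \<psi> \<psi> < 0}"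

definition temp :: "real^4 \<Rightarrow> real" where
  "temp \<psi> = 1 / sqrt (- mprod \<psi> \<psi>)"

definition velocity :: "real^4 \<Rightarrow> real^4" where
  "velocity \<psi> = temp \<psi> *\<^sub>R \<psi>"

definition projector :: "real^4 \<Rightarrow> 4 \<Rightarrow> 4 \<Rightarrow> real" where
  "projector \<psi> \<alpha> \<beta> = mink $ \<alpha> $ \<beta> + velocity \<psi> $ \<alpha> * velocity \<psi> $ \<beta>"

text \<open>Throughout, \<open>p\<close> is the pressure as a function of the temperature.\<close>

definition energy_momentum :: "(real \<Rightarrow> real) \<Rightarrow> real^4 \<Rightarrow> 4 \<Rightarrow> 4 \<Rightarrow> real" where
  "energy_momentum p \<psi> \<alpha> \<beta> =
     temp \<psi> ^ 3 * deriv p (temp \<psi>) * \<psi> $ \<alpha> * \<psi> $ \<beta> + p (temp \<psi>) * mink $ \<alpha> $ \<beta>"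

lemma energy_momentum_eq_pd_lower:
  assumes "\<psi> \<in> states" and "p differentiable (at (temp \<psi>))"
  shows "energy_momentum p \<psi> \<alpha> \<beta> = pd_lower \<alpha> (\<lambda>\<phi>. p (temp \<phi>) * \<phi> $ \<beta>) \<psi>"
proof -
  define e :: "real^4" where "e = mink *v axis \<alpha> 1"
  define c where "c = mprod \<psi> \<psi>"
  have c: "c < 0"
    using assms(1) by (simp add: c_def states_def)
  have e: "e $ \<beta> = mink $ \<alpha> $ \<beta>" for \<beta>
    by (simp add: e_def matrix_vector_mult_basis column_def mink_def)
  have ee: "mprod (\<psi> + h *\<^sub>R e) (\<psi> + h *\<^sub>R e) = c + 2 * h * \<psi> $ \<alpha> + h\<^sup>2 * mink $ \<alpha> $ \<alpha>" for h
    unfolding c_def mprod_expand using index_cases[of \<alpha>]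
    by (elim disjE) (simp_all add: e mink_def power2_eq_square algebra_simps)
  have sq: "temp (\<psi> + h *\<^sub>R e) = 1 / sqrt (- (c + 2 * h * \<psi> $ \<alpha> + h\<^sup>2 * mink $ \<alpha> $ \<alpha>))" for h
    by (simp add: temp_def ee)
  have t: "temp \<psi> = 1 / sqrt (- c)"
    by (simp add: temp_def c_def)
  have dtemp: "((\<lambda>h. temp (\<psi> + h *\<^sub>R e)) has_real_derivative temp \<psi> ^ 3 * \<psi> $ \<alpha>) (at 0)"
    unfolding sq t using c
    by (auto intro!: derivative_eq_intros simp: power3_eq_cube divide_simps)
  have dp: "(p has_real_derivative deriv p (temp \<psi>)) (at (temp (\<psi> + 0 *\<^sub>R e)))"
    using assms(2) DERIV_deriv_iff_real_differentiable by simp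
  have "((\<lambda>h. p (temp (\<psi> + h *\<^sub>R e)) * (\<psi> + h *\<^sub>R e) $ \<beta>) has_real_derivative
      energy_momentum p \<psi> \<alpha> \<beta>) (at 0)"
  proof -
    have "((\<lambda>h. (\<psi> + h *\<^sub>R e) $ \<beta>) has_real_derivative mink $ \<alpha> $ \<beta>) (at 0)"
      by (auto intro!: derivative_eq_intros simp: e)
    from DERIV_mult[OF DERIV_chain2[OF dp dtemp] this] show ?thesis
      by (simp add: energy_momentum_def mult_ac)
  qed
  then show ?thesis
    by (simp add: pd_lower_def e_def DERIV_imp_deriv)
qed

definition strictly_causal :: "(real \<Rightarrow> real) \<Rightarrow> bool" where
  "strictly_causal p \<longleftrightarrow>
     (\<forall>\<psi>\<in>states. \<forall>T. T $ 0 > 0 \<and> mprod T T \<le> 0 \<longrightarrow>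
        negative_definite (\<chi> \<alpha> \<gamma>. \<Sum>\<beta>\<in>UNIV.
          pd_lower \<alpha> (pd_lower \<gamma> (\<lambda>\<phi>. p (temp \<phi>) * \<phi> $ \<beta>)) \<psi> * (mink *v T) $ \<beta>))"

definition energy_density :: "(real \<Rightarrow> real) \<Rightarrow> real \<Rightarrow> real" where
  "energy_density p \<theta> = \<theta> * deriv p \<theta> - p \<theta>"

text \<open>
  The pressure as a function of the energy density. The energy density is a strictly increasing
  function of the temperature by strict causality; the value is meaningful on
  \<open>energy_density p ` {0<..}\<close>, which is then an open interval.
\<close>

definition pressure_of_density :: "(real \<Rightarrow> real) \<Rightarrow> real \<Rightarrow> real" where
  "pressure_of_density p \<rho> = p (THE \<theta>. \<theta> > 0 \<and> energy_density p \<theta> = \<rho>)"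

definition sound_speed_sq :: "(real \<Rightarrow> real) \<Rightarrow> real \<Rightarrow> real" where
  "sound_speed_sq p \<theta> = deriv (pressure_of_density p) (energy_density p \<theta>)"

definition genuinely_nonlinear :: "(real \<Rightarrow> real) \<Rightarrow> bool" where
  "genuinely_nonlinear p \<longleftrightarrow>
     (\<forall>\<rho> \<in> energy_density p ` {0<..}.
        (\<rho> + pressure_of_density p \<rho>) * deriv (deriv (pressure_of_density p)) \<rho>
        + 2 * (1 - deriv (pressure_of_density p) \<rho>) * deriv (pressure_of_density p) \<rho> > 0)"

section \<open>The dissipation tensor\<close>

text \<open>
  The tensor is a pointwise expression in the state \<open>\<psi>\<close> and the first derivatives of velocity and
  temperature: \<open>dU \<gamma> \<delta>\<close> stands for \<open>\<partial>U\<^sup>\<gamma>/\<partial>x\<^sup>\<delta>\<close> and \<open>d\<theta> \<delta>\<close> for \<open>\<partial>\<theta>/\<partial>x\<^sup>\<delta>\<close>. In the body, \<open>dUl \<gamma> \<delta>\<close> is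
  \<open>\<partial>U\<^sub>\<gamma>/\<partial>x\<^sup>\<delta>\<close> and \<open>d\<theta>u \<beta>\<close> is \<open>\<partial>\<theta>/\<partial>x\<^sub>\<beta>\<close>.
  The heat conductivity is called \<open>\<kappa>\<close>, as \<open>\<chi>\<close> is reserved syntax.
\<close>

definition dissipation_tensor ::
  "(real \<Rightarrow> real) \<Rightarrow> (real^4 \<Rightarrow> real) \<Rightarrow> (real^4 \<Rightarrow> real) \<Rightarrow> (real^4 \<Rightarrow> real) \<Rightarrow>
   real^4 \<Rightarrow> (4 \<Rightarrow> 4 \<Rightarrow> real) \<Rightarrow> (4 \<Rightarrow> real) \<Rightarrow> 4 \<Rightarrow> 4 \<Rightarrow> real" where
  "dissipation_tensor p \<eta> \<zeta> \<kappa> \<psi> dU d\<theta> \<alpha> \<beta> =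
    (let \<theta> = temp \<psi>;
         U = velocity \<psi>;
         P = projector \<psi>;
         c2 = sound_speed_sq p \<theta>;
         \<sigma> = (4/3 * \<eta> \<psi> + \<zeta> \<psi>) / (1 - c2) - c2 * \<kappa> \<psi> * \<theta>;
         \<zeta>' = \<zeta> \<psi> + c2 * \<sigma> - c2 * (1 - c2) * \<kappa> \<psi> * \<theta>;
         dUl = (\<lambda>\<gamma> \<delta>. \<Sum>\<epsilon>\<in>UNIV. mink $ \<gamma> $ \<epsilon> * dU \<epsilon> \<delta>);
         d\<theta>u = (\<lambda>\<beta>. \<Sum>\<delta>\<in>UNIV. mink $ \<beta> $ \<delta> * d\<theta> \<delta>);
         divU = (\<Sum>\<gamma>\<in>UNIV. dU \<gamma> \<gamma>)
     in - (\<eta> \<psi> * (\<Sum>\<gamma>\<in>UNIV. \<Sum>\<delta>\<in>UNIV.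
                      P \<alpha> \<gamma> * P \<beta> \<delta> * (dUl \<gamma> \<delta> + dUl \<delta> \<gamma> - 2/3 * mink $ \<gamma> $ \<delta> * divU))
           + \<zeta>' * P \<alpha> \<beta> * divU
           + \<sigma> * (U $ \<alpha> * U $ \<beta> * divU
                  - (\<Sum>\<gamma>\<in>UNIV. \<Sum>\<delta>\<in>UNIV. (P \<alpha> \<gamma> * U $ \<beta> + P \<beta> \<gamma> * U $ \<alpha>) * U $ \<delta> * dUl \<gamma> \<delta>))
           + \<kappa> \<psi> * (U $ \<alpha> * d\<theta>u \<beta> + U $ \<beta> * d\<theta>u \<alpha>
                    - mink $ \<alpha> $ \<beta> * (\<Sum>\<gamma>\<in>UNIV. U $ \<gamma> * d\<theta> \<gamma>))))"

text \<open>The dissipation tensor on functions of \<open>s = x\<^sup>\<beta> \<xi>\<^sub>\<beta>\<close>, i.e. with \<open>\<partial>/\<partial>x\<^sup>\<delta>\<close> replaced by \<open>\<xi>\<^sub>\<delta> d/ds\<close>.\<close>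

definition dissipation_along ::
  "(real \<Rightarrow> real) \<Rightarrow> (real^4 \<Rightarrow> real) \<Rightarrow> (real^4 \<Rightarrow> real) \<Rightarrow> (real^4 \<Rightarrow> real) \<Rightarrow>
   real^4 \<Rightarrow> (real \<Rightarrow> real^4) \<Rightarrow> real \<Rightarrow> 4 \<Rightarrow> 4 \<Rightarrow> real" where
  "dissipation_along p \<eta> \<zeta> \<kappa> \<xi> \<Psi> s =
     dissipation_tensor p \<eta> \<zeta> \<kappa> (\<Psi> s)
       (\<lambda>\<gamma> \<delta>. \<xi> $ \<delta> * deriv (\<lambda>t. velocity (\<Psi> t) $ \<gamma>) s)
       (\<lambda>\<delta>. \<xi> $ \<delta> * deriv (\<lambda>t. temp (\<Psi> t)) s)"

section \<open>Shocks\<close>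

definition normal_flux :: "(real \<Rightarrow> real) \<Rightarrow> real^4 \<Rightarrow> real^4 \<Rightarrow> 4 \<Rightarrow> real" where
  "normal_flux p \<xi> \<psi> \<alpha> = (\<Sum>\<beta>\<in>UNIV. \<xi> $ \<beta> * energy_momentum p \<psi> \<alpha> \<beta>)"

definition shock :: "(real \<Rightarrow> real) \<Rightarrow> real^4 \<Rightarrow> real^4 \<Rightarrow> real^4 \<Rightarrow> bool" where
  "shock p \<psi>m \<psi>p \<xi> \<longleftrightarrow>
     \<psi>m \<in> states \<and> \<psi>p \<in> states \<and> \<psi>m \<noteq> \<psi>p \<and> mprod \<xi> \<xi> = 1 \<and>
     (\<forall>\<alpha>. normal_flux p \<xi> \<psi>m \<alpha> = normal_flux p \<xi> \<psi>p \<alpha>)"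

text \<open>
  The polynomial \<open>det (\<partial>T\<^sup>\<alpha>\<^sup>1/\<partial>\<psi>\<^sub>\<gamma> - \<lambda> \<partial>T\<^sup>\<alpha>\<^sup>0/\<partial>\<psi>\<^sub>\<gamma>)\<close> in \<open>\<lambda>\<close>.
\<close>

definition char_polynomial :: "(real \<Rightarrow> real) \<Rightarrow> real^4 \<Rightarrow> real poly" where
  "char_polynomial p \<psi> =
     det (\<chi> \<alpha> \<gamma>. [: pd_lower \<gamma> (\<lambda>\<phi>. energy_momentum p \<phi> \<alpha> 1) \<psi>,
                    - pd_lower \<gamma> (\<lambda>\<phi>. energy_momentum p \<phi> \<alpha> 0) \<psi> :])"

text \<open>The characteristic speeds at \<open>\<psi>\<close> in the direction \<open>(0,1,0,0)\<close>.\<close>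

definition char_speeds ::
  "(real \<Rightarrow> real) \<Rightarrow> real^4 \<Rightarrow> real \<Rightarrow> real \<Rightarrow> real \<Rightarrow> real \<Rightarrow> bool" where
  "char_speeds p \<psi> l1 l2 l3 l4 \<longleftrightarrow>
     char_polynomial p \<psi> \<noteq> 0 \<and> proots (char_polynomial p \<psi>) = {#l1, l2, l3, l4#} \<and>
     l1 < l2 \<and> l2 = l3 \<and> l3 < l4"

text \<open>
  The signs of the speeds are read off in an inertial frame, with coordinates \<open>L *v x\<close>, in which \<open>\<xi>\<close>
  has the components \<open>(0,1,0,0)\<close>; they do not depend on the choice of this frame. A covector with
  components \<open>\<xi>'\<close> in the new frame has components \<open>\<xi>' v* L\<close> in the old one.
\<close>

definition lax_shock :: "(real \<Rightarrow> real) \<Rightarrow> real^4 \<Rightarrow> real^4 \<Rightarrow> real^4 \<Rightarrow> bool" where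
  "lax_shock p \<psi>m \<psi>p \<xi> \<longleftrightarrow>
     shock p \<psi>m \<psi>p \<xi> \<and>
     (\<exists>L l1 l2 l3 l4 m1 m2 m3 m4.
        orthochronous L \<and> axis 1 1 v* L = \<xi> \<and>
        char_speeds p (L *v \<psi>m) l1 l2 l3 l4 \<and>
        char_speeds p (L *v \<psi>p) m1 m2 m3 m4 \<and>
        ((0 < l1 \<and> 0 < l2 \<and> 0 < l3 \<and> 0 < l4 \<and> m1 < 0 \<and> 0 < m2) \<or>
         (m1 < 0 \<and> m2 < 0 \<and> m3 < 0 \<and> m4 < 0 \<and> l3 < 0 \<and> 0 < l4)))"

definition dissipation_profile ::
  "(real \<Rightarrow> real) \<Rightarrow> (real^4 \<Rightarrow> real) \<Rightarrow> (real^4 \<Rightarrow> real) \<Rightarrow> (real^4 \<Rightarrow> real) \<Rightarrow>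
   real^4 \<Rightarrow> real^4 \<Rightarrow> real^4 \<Rightarrow> (real \<Rightarrow> real^4) \<Rightarrow> bool" where
  "dissipation_profile p \<eta> \<zeta> \<kappa> \<psi>m \<psi>p \<xi> \<Psi> \<longleftrightarrow>
     smooth_on UNIV \<Psi> \<and> range \<Psi> \<subseteq> states \<and>
     (\<forall>s \<alpha>. - (\<Sum>\<beta>\<in>UNIV. \<xi> $ \<beta> * dissipation_along p \<eta> \<zeta> \<kappa> \<xi> \<Psi> s \<alpha> \<beta>) =
            normal_flux p \<xi> (\<Psi> s) \<alpha> - normal_flux p \<xi> \<psi>m \<alpha>) \<and>
     (\<Psi> \<longlongrightarrow> \<psi>m) at_bot \<and> (\<Psi> \<longlongrightarrow> \<psi>p) at_top"

end

theory Submission imports Defs begin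

text \<open>
  Without heat conduction the dissipative flux along a profile is \<open>\<sigma> U'\<close>. Its component along \<open>U\<close>
  vanishes, so that the profile equation confines \<open>U\<close> to a plane and determines it as a function of
  the temperature \<open>\<theta>\<close>; what remains is a scalar equation for \<open>\<theta>\<close>. Its right-hand side is a nonzero
  multiple of \<open>H = (q1 - p) (q1 + \<rho>) - q0\<^sup>2\<close>, where \<open>q0\<close> and \<open>q1\<close> are the components of the flux
  vector \<open>q\<close> orthogonal to and along the normal. \<open>H\<close> vanishes at the temperatures of both states of
  the shock, and genuine nonlinearity excludes interior minima of \<open>H\<close>, so \<open>H\<close> is positive in between
  and there is a heteroclinic orbit. The Lax condition says which state is supersonic, this is the
  colder one, and the sign of the normal velocity gives the direction of the orbit.
\<close>

section \<open>Smooth functions\<close>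

text \<open>Write \<open>U = r N + v X\<close> with \<open>r\<^sup>2 = 1 + v\<^sup>2\<close>. The
  flux of a state is \<open>w v U + p X\<close> with \<open>w = \<rho> + p\<close>; its product with
  \<open>U\<close> is \<open>- \<rho> v\<close>, that of \<open>q\<close> is
  \<open>- q0 r + q1 v\<close>. Since \<open>U'\<close> is orthogonal to \<open>U\<close>, the two
  agree along a profile, which gives \<open>v (\<rho> + q1) = q0 r\<close>. Hence \<open>U\<close>
  is \<open>b N + q0 X\<close> normalised, with \<open>b = \<rho> + q1\<close>. The flux deficit and
  \<open>dU/d\<theta>\<close> are then both multiples of \<open>q0 N + b X\<close>, the direction
  orthogonal to \<open>U\<close> in the plane, so that the four equations collapse to one. At a
  state of the shock \<open>q1 - p = w v\<^sup>2\<close>, \<open>q1 + \<rho> = w r\<^sup>2\<close>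
  and \<open>q0 = w v r\<close>, which is why \<open>H\<close> vanishes there. The derivative of
  \<open>H\<close> is \<open>d\<rho>/d\<theta>\<close> times \<open>E\<close>, and at such a state
  \<open>E = w (v\<^sup>2 - c\<^sup>2 (1 + v\<^sup>2))\<close> with the sound speed
  \<open>c\<close>: \<open>E\<close> is positive exactly at supersonic states. At the hotter zero
  \<open>H\<close> comes down from positive values, so \<open>E\<close> is nonpositive there. This
  is how the supersonic state is recognised as the colder one.\<close>

lemma Ck_on_cong:
  assumes "open S" "\<And>x. x \<in> S \<Longrightarrow> f x = g x" "Ck_on k S f"
  shows "Ck_on k S g"
  using assms(2,3)
proof (induction k arbitrary: f g)
  case 0
  then show ?case
    using continuous_on_cong by (metis Ck_on.simps(1))
next
  case (Suc k)
  have d: "f differentiable (at x)" if "x \<in> S" for x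
    using Suc.prems(2) that by simp
  have "g differentiable (at x)" if "x \<in> S" for x
    using d[OF that] assms(1) Suc.prems(1) that unfolding differentiable_def
    by (meson has_derivative_transform_within_open)
  moreover have "Ck_on k S (\<lambda>x. frechet_derivative g (at x) v)" for v
  proof (rule Suc.IH)
    show "Ck_on k S (\<lambda>x. frechet_derivative f (at x) v)"
      using Suc.prems(2) by simp
    show "frechet_derivative f (at x) v = frechet_derivative g (at x) v" if "x \<in> S" for x
      using frechet_derivative_transform_within_open[OF d[OF that] assms(1) that Suc.prems(1)]
      by simp
  qed
  ultimately show ?case
    unfolding Ck_on.simps by blast
qed

text \<open>\<open>Ck_on\<close> is phrased with \<open>frechet_derivative\<close>. On an open set
  any explicit derivative may take its place, so that the inductions below can use the usual
  differentiation rules.\<close>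

lemma Ck_on_SucI:
  assumes "open S" "\<And>x. x \<in> S \<Longrightarrow> (f has_derivative f' x) (at x)"
    and "\<And>v. Ck_on k S (\<lambda>x. f' x v)"
  shows "Ck_on (Suc k) S f"
proof -
  have "Ck_on k S (\<lambda>x. frechet_derivative f (at x) v)" for v
    by (rule Ck_on_cong[OF assms(1) _ assms(3)[of v]])
      (simp add: frechet_derivative_at[OF assms(2), symmetric])
  then show ?thesis
    using assms(2) unfolding Ck_on.simps differentiable_def by blast
qed

lemma Ck_on_SucD: "Ck_on (Suc k) S f \<Longrightarrow> Ck_on k S f"
proof (induction k arbitrary: f)
  case 0
  then show ?case
    by (auto intro: continuous_at_imp_continuous_on differentiable_imp_continuous_within)
qed simp

lemma Ck_on_Suc_has_derivative:
  "Ck_on (Suc k) S f \<Longrightarrow> x \<in> S \<Longrightarrow> (f has_derivative frechet_derivative f (at x)) (at x)"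
  using frechet_derivative_works by auto

lemma Ck_on_subset: "Ck_on k S f \<Longrightarrow> T \<subseteq> S \<Longrightarrow> Ck_on k T f"
  by (induction k arbitrary: f) (auto intro: continuous_on_subset)

lemma Ck_on_const: "Ck_on k S (\<lambda>x. c)"
  by (induction k arbitrary: c) auto

lemma Ck_on_ident: "Ck_on k S (\<lambda>x. x)"
  by (cases k) (auto simp: Ck_on_const)

lemma Ck_on_add:
  assumes "open S" "Ck_on k S f" "Ck_on k S g"
  shows "Ck_on k S (\<lambda>x. f x + g x)"
  using assms(2,3)
proof (induction k arbitrary: f g)
  case 0
  then show ?case
    by (auto intro: continuous_on_add)
next
  case (Suc k)
  show ?case
  proof (rule Ck_on_SucI[OF assms(1)])
    show "((\<lambda>x. f x + g x) has_derivative
        (\<lambda>v. frechet_derivative f (at x) v + frechet_derivative g (at x) v)) (at x)"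
      if "x \<in> S" for x
      using Suc.prems[THEN Ck_on_Suc_has_derivative, OF that] by (rule has_derivative_add)
  qed (use Suc in auto)
qed

lemma Ck_on_sum:
  assumes "open S" "\<And>i. i \<in> I \<Longrightarrow> Ck_on k S (f i)"
  shows "Ck_on k S (\<lambda>x. \<Sum>i\<in>I. f i x)"
  using assms(2)
  by (induction I rule: infinite_finite_induct) (auto intro: Ck_on_const Ck_on_add assms(1))

lemma (in bounded_bilinear) Ck_on:
  assumes "open S" "Ck_on k S f" "Ck_on k S g"
  shows "Ck_on k S (\<lambda>x. prod (f x) (g x))"
  using assms(2,3)
proof (induction k arbitrary: f g)
  case 0
  then show ?case
    by (auto intro: continuous_on)
next
  case (Suc k)
  show ?case
  proof (rule Ck_on_SucI[OF assms(1)])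
    show "((\<lambda>x. prod (f x) (g x)) has_derivative
        (\<lambda>v. prod (f x) (frechet_derivative g (at x) v) + prod (frechet_derivative f (at x) v) (g x))) (at x)"
      if "x \<in> S" for x
      using Suc.prems[THEN Ck_on_Suc_has_derivative, OF that] by (rule FDERIV)
    show "Ck_on k S (\<lambda>x. prod (f x) (frechet_derivative g (at x) v)
        + prod (frechet_derivative f (at x) v) (g x))" for v
      using Suc.prems[THEN Ck_on_SucD] Suc.prems
      by (intro Ck_on_add[OF assms(1)] Suc.IH) auto
  qed
qed

text \<open>The derivative of the composite applies the derivative of \<open>g\<close> in the
  direction \<open>?f' x v\<close>, which depends on \<open>x\<close>, whereas \<open>Ck_on\<close>
  controls fixed directions only. Expanding that direction in \<open>Basis\<close> leaves a finite
  sum of coefficients times partial derivatives of \<open>g\<close> composed with \<open>f\<close>;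
  this is why the middle space is Euclidean.\<close>

lemma Ck_on_compose:
  fixes f :: "'a::real_normed_vector \<Rightarrow> 'b::euclidean_space"
    and g :: "'b \<Rightarrow> 'c::real_normed_vector"
  assumes "open S" "Ck_on k S f" "Ck_on k T g" "f ` S \<subseteq> T"
  shows "Ck_on k S (\<lambda>x. g (f x))"
  using assms(2-)
proof (induction k arbitrary: g)
  case 0
  then show ?case
    using continuous_on_compose2 by (metis Ck_on.simps(1))
next
  case (Suc k)
  let ?f' = "\<lambda>x. frechet_derivative f (at x)" and ?g' = "\<lambda>y. frechet_derivative g (at y)"
  have g': "?g' (f x) (?f' x v) = (\<Sum>i\<in>Basis. (?f' x v \<bullet> i) *\<^sub>R ?g' (f x) i)" if "x \<in> S" for x v
  proof -
    have lin: "linear (?g' (f x))"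
      using Suc.prems(2,3) that by (intro linear_frechet_derivative) auto
    have "?g' (f x) (\<Sum>i\<in>Basis. (?f' x v \<bullet> i) *\<^sub>R i)
        = (\<Sum>i\<in>Basis. (?f' x v \<bullet> i) *\<^sub>R ?g' (f x) i)"
      by (simp only: linear_sum[OF lin] linear_cmul[OF lin])
    then show ?thesis
      by (simp only: euclidean_representation)
  qed
  have chain: "((\<lambda>x. g (f x)) has_derivative (\<lambda>v. ?g' (f x) (?f' x v))) (at x)" if "x \<in> S" for x
  proof -
    have "(g has_derivative ?g' (f x)) (at (f x))"
      using Suc.prems that by (intro Ck_on_Suc_has_derivative) auto
    from has_derivative_compose[OF Ck_on_Suc_has_derivative[OF Suc.prems(1) that] this]
    show ?thesis .
  qed
  show ?case
  proof (rule Ck_on_SucI[OF assms(1)])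
    show "((\<lambda>x. g (f x)) has_derivative (\<lambda>v. \<Sum>i\<in>Basis. (?f' x v \<bullet> i) *\<^sub>R ?g' (f x) i)) (at x)"
      if "x \<in> S" for x
      using chain[OF that] by (simp only: g'[OF that])
    show "Ck_on k S (\<lambda>x. \<Sum>i\<in>Basis. (?f' x v \<bullet> i) *\<^sub>R ?g' (f x) i)" for v
    proof (intro Ck_on_sum bounded_bilinear.Ck_on[OF bounded_bilinear_scaleR]
        bounded_bilinear.Ck_on[OF bounded_bilinear_inner] Ck_on_const assms(1))
      show "Ck_on k S (\<lambda>x. ?f' x v)"
        using Suc.prems by simp
      show "Ck_on k S (\<lambda>x. ?g' (f x) i)" for i
        using Suc.IH[of "\<lambda>y. ?g' y i"] Suc.prems Ck_on_SucD[OF Suc.prems(1)] by simp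
    qed
  qed
qed

text \<open>An arbitrary exponent keeps the induction closed, since differentiation lowers it by
  one. The exponents \<open>-1\<close> and \<open>1/2\<close> later give reciprocals and square
  roots.\<close>

lemma Ck_on_powr: "Ck_on k {0<..} (\<lambda>x::real. x powr r)"
proof (induction k arbitrary: r)
  case 0
  show ?case
    unfolding Ck_on.simps by (intro continuous_on_powr continuous_on_id continuous_on_const) auto
next
  case (Suc k)
  show ?case
  proof (rule Ck_on_SucI)
    show "((\<lambda>x. x powr r) has_derivative (\<lambda>v. (r * x powr (r - 1)) * v)) (at x)"
      if "x \<in> {0<..}" for x
      using that has_real_derivative_powr[of x r] by (simp add: has_field_derivative_def)
    show "Ck_on k {0<..} (\<lambda>x. (r * x powr (r - 1)) * v)" for v
      by (intro bounded_bilinear.Ck_on[OF bounded_bilinear_mult] Ck_on_const Suc) auto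
  qed auto
qed

section \<open>Closure rules for \<open>smooth_on\<close>\<close>

lemma smooth_on_const: "smooth_on S (\<lambda>x. c)"
  by (simp add: smooth_on_def Ck_on_const)

lemma smooth_on_ident: "smooth_on S (\<lambda>x. x)"
  by (simp add: smooth_on_def Ck_on_ident)

lemma smooth_on_subset: "smooth_on S f \<Longrightarrow> T \<subseteq> S \<Longrightarrow> smooth_on T f"
  using Ck_on_subset unfolding smooth_on_def by blast

lemma smooth_on_cong:
  "open S \<Longrightarrow> (\<And>x. x \<in> S \<Longrightarrow> f x = g x) \<Longrightarrow> smooth_on S f \<Longrightarrow> smooth_on S g"
  unfolding smooth_on_def by (blast intro: Ck_on_cong)

lemma smooth_on_add:
  "open S \<Longrightarrow> smooth_on S f \<Longrightarrow> smooth_on S g \<Longrightarrow> smooth_on S (\<lambda>x. f x + g x)"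
  by (simp add: smooth_on_def Ck_on_add)

lemma smooth_on_scaleR:
  "open S \<Longrightarrow> smooth_on S f \<Longrightarrow> smooth_on S g \<Longrightarrow> smooth_on S (\<lambda>x. f x *\<^sub>R g x)"
  by (simp add: smooth_on_def bounded_bilinear.Ck_on[OF bounded_bilinear_scaleR])

lemma smooth_on_mult:
  fixes f g :: "'a::real_normed_vector \<Rightarrow> real"
  shows "open S \<Longrightarrow> smooth_on S f \<Longrightarrow> smooth_on S g \<Longrightarrow> smooth_on S (\<lambda>x. f x * g x)"
  by (simp add: smooth_on_def bounded_bilinear.Ck_on[OF bounded_bilinear_mult])

lemma smooth_on_diff:
  fixes f g :: "'a::real_normed_vector \<Rightarrow> real"
  assumes "open S" "smooth_on S f" "smooth_on S g"
  shows "smooth_on S (\<lambda>x. f x - g x)"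
  using smooth_on_add[OF assms(1,2) smooth_on_mult[OF assms(1) smooth_on_const[of S "-1"] assms(3)]]
  by simp

lemma smooth_on_compose:
  fixes f :: "'a::real_normed_vector \<Rightarrow> 'b::euclidean_space"
  assumes "open S" "smooth_on S f" "smooth_on T g" "f ` S \<subseteq> T"
  shows "smooth_on S (\<lambda>x. g (f x))"
proof -
  have "Ck_on k S (\<lambda>x. g (f x))" for k
    using Ck_on_compose[OF assms(1) _ _ assms(4), of k g] assms(2,3) by (simp add: smooth_on_def)
  then show ?thesis
    by (simp add: smooth_on_def)
qed

lemma smooth_on_powr:
  fixes f :: "'a::real_normed_vector \<Rightarrow> real"
  assumes "open S" "smooth_on S f" "\<And>x. x \<in> S \<Longrightarrow> f x > 0"
  shows "smooth_on S (\<lambda>x. f x powr r)"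
proof (rule smooth_on_compose[OF assms(1,2)])
  show "smooth_on {0<..} (\<lambda>y::real. y powr r)"
    by (simp only: smooth_on_def Ck_on_powr simp_thms)
qed (use assms(3) in auto)

lemma smooth_on_inverse:
  fixes f :: "'a::real_normed_vector \<Rightarrow> real"
  assumes "open S" "smooth_on S f" "\<And>x. x \<in> S \<Longrightarrow> f x > 0"
  shows "smooth_on S (\<lambda>x. inverse (f x))"
  by (rule smooth_on_cong[OF assms(1) _ smooth_on_powr[OF assms, where r = "-1"]])
    (use assms(3) in \<open>simp add: powr_minus abs_of_pos\<close>)

lemma smooth_on_sqrt:
  fixes f :: "'a::real_normed_vector \<Rightarrow> real"
  assumes "open S" "smooth_on S f" "\<And>x. x \<in> S \<Longrightarrow> f x > 0"
  shows "smooth_on S (\<lambda>x. sqrt (f x))"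
  by (rule smooth_on_cong[OF assms(1) _ smooth_on_powr[OF assms, where r = "1/2"]])
    (use assms(3) in \<open>simp add: powr_half_sqrt less_imp_le\<close>)

lemma smooth_on_imp_differentiable:
  "smooth_on S f \<Longrightarrow> x \<in> S \<Longrightarrow> f differentiable (at x)"
  unfolding smooth_on_def by (metis Ck_on.simps(2))

lemma smooth_on_has_real_derivative:
  "smooth_on S f \<Longrightarrow> x \<in> S \<Longrightarrow> (f has_real_derivative deriv f x) (at x)"
  using smooth_on_imp_differentiable DERIV_deriv_iff_real_differentiable by blast

lemma smooth_on_deriv:
  fixes f :: "real \<Rightarrow> real"
  assumes "open S" "smooth_on S f"
  shows "smooth_on S (deriv f)"
proof (rule smooth_on_cong[OF assms(1)])
  show "smooth_on S (\<lambda>x. frechet_derivative f (at x) 1)"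
    using assms(2) unfolding smooth_on_def by (metis Ck_on.simps(2))
  show "frechet_derivative f (at x) 1 = deriv f x" if "x \<in> S" for x
    using frechet_derivative_at[OF smooth_on_has_real_derivative[OF assms(2) that,
        unfolded has_field_derivative_def]] by (metis mult.right_neutral)
qed

text \<open>Bootstrapping: if \<open>\<theta>\<close> is of class \<open>k\<close>, so is
  \<open>\<lambda>s. g (\<theta> s)\<close>, which is the derivative of
  \<open>\<theta>\<close>.\<close>

lemma smooth_on_ode_solution:
  fixes \<theta> g :: "real \<Rightarrow> real"
  assumes "\<And>s. (\<theta> has_real_derivative g (\<theta> s)) (at s)" "smooth_on S g" "range \<theta> \<subseteq> S"
  shows "smooth_on UNIV \<theta>"
proof -
  have "Ck_on k UNIV \<theta>" for k
  proof (induction k)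
    case 0
    show ?case
      using DERIV_isCont[OF assms(1)] by (simp add: continuous_at_imp_continuous_on)
  next
    case (Suc k)
    show ?case
    proof (rule Ck_on_SucI)
      show "(\<theta> has_derivative (\<lambda>v. g (\<theta> s) * v)) (at s)" for s
        using assms(1) by (simp add: has_field_derivative_def)
      show "Ck_on k UNIV (\<lambda>s. g (\<theta> s) * v)" for v
        using Ck_on_compose[OF _ Suc, where T = S and g = g] assms(2,3)
        by (intro bounded_bilinear.Ck_on[OF bounded_bilinear_mult] Ck_on_const)
          (simp_all add: smooth_on_def)
    qed auto
  qed
  then show ?thesis
    by (simp add: smooth_on_def)
qed

section \<open>Heteroclinic orbits of scalar equations\<close>

lemma has_real_derivative_local_inverse:
  fixes f g :: "real \<Rightarrow> real"
  assumes "open S" "x \<in> S" "\<And>y. y \<in> S \<Longrightarrow> g (f y) = y"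
    and "\<And>y. y \<in> S \<Longrightarrow> f differentiable (at y)"
    and "(f has_real_derivative D) (at x)" "D \<noteq> 0"
  shows "(g has_real_derivative 1 / D) (at (f x))"
proof -
  have "continuous_on S f"
    using assms(4) by (meson differentiable_imp_continuous_within continuous_at_imp_continuous_on)
  moreover have "(*) D \<circ> (*) (1 / D) = id"
    using assms(6) by (auto simp: fun_eq_iff)
  ultimately show ?thesis
    using has_derivative_inverse_strong[of S x f g "(*) D" "(*) (1 / D)"] assms(1-3,5)
    by (simp add: has_field_derivative_def)
qed

text \<open>For a positive \<open>g\<close> the linear bound makes \<open>1 / g\<close> at least
  \<open>1 / (C \<bar>x - z\<bar>)\<close> near \<open>z\<close>, hence not integrable: an orbit
  needs infinite time to reach the equilibrium.\<close>

lemma differentiable_linear_bound_at_zero: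
  fixes g :: "real \<Rightarrow> real"
  assumes "g differentiable (at z)" "g z = 0"
  obtains C d where "C > 0" "d > 0" "\<And>x. \<bar>x - z\<bar> < d \<Longrightarrow> \<bar>g x\<bar> \<le> C * \<bar>x - z\<bar>"
proof -
  obtain D where D: "(g has_real_derivative D) (at z)"
    using assms(1) real_differentiable_def by blast
  then have "((\<lambda>x. g x / (x - z)) \<longlongrightarrow> D) (at z)"
    using assms(2) by (simp add: has_field_derivative_iff)
  then have "\<forall>\<^sub>F x in at z. dist (g x / (x - z)) D < 1"
    by (rule tendstoD) simp
  then obtain d where d: "d > 0" "\<And>x. x \<noteq> z \<Longrightarrow> dist x z < d \<Longrightarrow> dist (g x / (x - z)) D < 1"
    unfolding eventually_at by blast
  show ?thesis
  proof
    fix x assume x: "\<bar>x - z\<bar> < d"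
    show "\<bar>g x\<bar> \<le> (\<bar>D\<bar> + 1) * \<bar>x - z\<bar>"
    proof (cases "x = z")
      case False
      then have "\<bar>g x / (x - z) - D\<bar> < 1"
        using d(2)[OF False] x by (simp add: dist_real_def)
      then have "\<bar>g x / (x - z)\<bar> \<le> \<bar>D\<bar> + 1"
        by linarith
      then show ?thesis
        using False by (simp add: abs_divide pos_divide_le_eq)
    qed (simp add: assms(2))
  qed (use d in auto)
qed

lemma antiderivative_unbounded_right:
  fixes T g :: "real \<Rightarrow> real"
  assumes "a < b" "\<And>x. a < x \<Longrightarrow> x < b \<Longrightarrow> g x > 0" "g b = 0" "g differentiable (at b)"
    and T: "\<And>x. a < x \<Longrightarrow> x < b \<Longrightarrow> (T has_real_derivative 1 / g x) (at x)"
  shows "\<exists>x. a < x \<and> x < b \<and> y < T x"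
proof -
  obtain C d where C: "C > 0" "d > 0" and bound: "\<And>x. \<bar>x - b\<bar> < d \<Longrightarrow> \<bar>g x\<bar> \<le> C * \<bar>x - b\<bar>"
    using differentiable_linear_bound_at_zero[OF assms(4,3)] by blast
  then have gC: "g x \<le> C * (b - x)" if "b - d < x" "x < b" for x
  proof -
    have "\<bar>g x\<bar> \<le> C * \<bar>x - b\<bar>"
      using that by (intro bound) auto
    then show ?thesis
      using that by (auto simp: abs_if split: if_splits)
  qed
  \<comment> \<open>A point of the interval from which on the linear bound at \<open>b\<close> is
    available.\<close>
  define c where "c = max ((a + b) / 2) (b - d / 2)"
  have c: "a < c" "c < b" "b - d < c"
    using assms(1) C by (auto simp: c_def max_def field_simps)
  \<comment> \<open>\<open>T\<close> grows at least as fast as the logarithm that the linear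
    right-hand side \<open>C * (b - x)\<close> would produce.\<close>
  have lower: "T x \<ge> T c + (ln (b - c) - ln (b - x)) / C" if "c \<le> x" "x < b" for x
  proof -
    have "T c + ln (b - c) / C \<le> T x + ln (b - x) / C"
    proof (rule DERIV_nonneg_imp_nondecreasing[OF that(1)])
      fix t assume "c \<le> t" "t \<le> x"
      then have t: "a < t" "t < b" "b - d < t"
        using c that by auto
      have "((\<lambda>x. T x + ln (b - x) / C) has_real_derivative 1 / g t - 1 / (C * (b - t))) (at t)"
        using T[OF t(1,2)] t C by (auto intro!: derivative_eq_intros simp: divide_simps)
      moreover have "1 / (C * (b - t)) \<le> 1 / g t"
        using gC[OF t(3,2)] assms(2)[OF t(1,2)] by (simp add: frac_le)
      ultimately show "\<exists>y. ((\<lambda>x. T x + ln (b - x) / C) has_real_derivative y) (at t) \<and> 0 \<le> y"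
        by fastforce
    qed
    then show ?thesis
      by (simp add: diff_divide_distrib)
  qed
  define r where "r = C * (\<bar>y - T c\<bar> + 1)"
  \<comment> \<open>Chosen so that \<open>ln (b - x) = ln (b - c) - r\<close>; the lower bound then
    exceeds \<open>y\<close> because \<open>r / C > y - T c\<close>.\<close>
  define x where "x = b - (b - c) * exp (- r)"
  have r: "r > 0" "y - T c < r / C"
    using C by (auto simp: r_def)
  have "(b - c) * exp (- r) \<le> (b - c) * 1"
    using c r by (intro mult_left_mono) auto
  then have "c \<le> x"
    by (simp add: x_def)
  moreover have "x < b"
    using c by (simp add: x_def)
  ultimately have x: "c \<le> x" "x < b" .
  have "ln (b - x) = ln (b - c) - r"
    using c by (simp add: x_def ln_mult)
  then have "T x \<ge> T c + r / C"
    using lower[OF x] by simp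
  then show ?thesis
    using r c x by (intro exI[of _ x]) auto
qed

lemma antiderivative_unbounded_left:
  fixes T g :: "real \<Rightarrow> real"
  assumes "a < b" "\<And>x. a < x \<Longrightarrow> x < b \<Longrightarrow> g x > 0" "g a = 0" "g differentiable (at a)"
    and T: "\<And>x. a < x \<Longrightarrow> x < b \<Longrightarrow> (T has_real_derivative 1 / g x) (at x)"
  shows "\<exists>x. a < x \<and> x < b \<and> T x < y"
proof -
  \<comment> \<open>Reflection in the origin, with \<open>- T (- x)\<close> as the antiderivative,
    turns the left end into the right one.\<close>
  have "\<exists>x. - b < x \<and> x < - a \<and> - y < - T (- x)"
  proof (rule antiderivative_unbounded_right[where g = "\<lambda>x. g (- x)"])
    show "(\<lambda>x. g (- x)) differentiable (at (- a))"
      using differentiable_compose[of g uminus "- a"] assms(4) by simp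
    show "((\<lambda>x. - T (- x)) has_real_derivative 1 / g (- x)) (at x)" if "- b < x" "x < - a" for x
    proof -
      have "(T has_real_derivative 1 / g (- x)) (at (- x))"
        using that by (intro T) auto
      from DERIV_minus[OF DERIV_chain2[OF this DERIV_minus[OF DERIV_ident]]] show ?thesis
        by simp
    qed
  qed (use assms in auto)
  then obtain x where "- b < x" "x < - a" "- y < - T (- x)"
    by blast
  then show ?thesis
    by (intro exI[of _ "- x"]) auto
qed

text \<open>The orbit is the inverse of an antiderivative of \<open>1 / g\<close>. As \<open>g\<close> is differentiable at its
  zeros \<open>a\<close> and \<open>b\<close>, the antiderivative is unbounded at both ends.\<close>

lemma heteroclinic_orbit:
  fixes g :: "real \<Rightarrow> real"
  assumes "a < b" "\<And>x. a < x \<Longrightarrow> x < b \<Longrightarrow> g x > 0" "g a = 0" "g b = 0"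
    and "\<And>x. a \<le> x \<Longrightarrow> x \<le> b \<Longrightarrow> g differentiable (at x)"
  obtains \<theta> where "\<And>s. (\<theta> has_real_derivative g (\<theta> s)) (at s)" "range \<theta> \<subseteq> {a<..<b}"
    "(\<theta> \<longlongrightarrow> a) at_bot" "(\<theta> \<longlongrightarrow> b) at_top"
proof -
  have "isCont (\<lambda>x. 1 / g x) x" if "a < x" "x < b" for x
    using assms(2,5) that
    by (intro continuous_intros differentiable_imp_continuous_within) (auto simp: less_le)
  then obtain T where "\<And>x. a < x \<Longrightarrow> x < b \<Longrightarrow> (T has_vector_derivative 1 / g x) (at x)"
    using einterval_antiderivative[of a b "\<lambda>x. 1 / g x"] assms(1) by auto
  then have T: "(T has_real_derivative 1 / g x) (at x)" if "a < x" "x < b" for x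
    using that by (simp add: has_real_derivative_iff_has_vector_derivative)
  have T_less: "T x < T y" if "a < x" "x < y" "y < b" for x y
  proof (rule DERIV_pos_imp_increasing[OF that(2)])
    fix t assume t: "x \<le> t" "t \<le> y"
    show "\<exists>z. (T has_real_derivative z) (at t) \<and> 0 < z"
      by (rule exI[of _ "1 / g t"]) (use T[of t] assms(2)[of t] t that in auto)
  qed
  have inj: "inj_on T {a<..<b}"
    using T_less by (metis (no_types, lifting) greaterThanLessThan_iff inj_onI linorder_neqE_linordered_idom less_irrefl)
  have surj: "\<exists>x. x \<in> {a<..<b} \<and> T x = s" for s
  proof -
    obtain x where x: "a < x" "x < b" "T x < s"
      using antiderivative_unbounded_left[OF assms(1-3) assms(5) T, of s] assms(1) by auto
    obtain y where y: "a < y" "y < b" "s < T y"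
      using antiderivative_unbounded_right[OF assms(1,2,4) assms(5) T, of s] assms(1) by auto
    have "x \<le> y"
      using T_less[of y x] x y by linarith
    then obtain z where "x \<le> z" "z \<le> y" "T z = s"
      using IVT[of T x s y] T x y DERIV_isCont by (smt (verit))
    then show ?thesis
      using x y by (intro exI[of _ z]) auto
  qed
  define \<theta> where "\<theta> = inv_into {a<..<b} T"
  have \<theta>_T: "\<theta> (T x) = x" if "x \<in> {a<..<b}" for x
    using that inj by (simp add: \<theta>_def)
  have T_\<theta>: "T (\<theta> s) = s" and \<theta>_in: "\<theta> s \<in> {a<..<b}" for s
  proof -
    have "s \<in> T ` {a<..<b}"
      using surj[of s] by (auto simp del: greaterThanLessThan_iff)
    then show "T (\<theta> s) = s" "\<theta> s \<in> {a<..<b}"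
      unfolding \<theta>_def by (rule f_inv_into_f, rule inv_into_into)
  qed
  have \<theta>': "(\<theta> has_real_derivative g (\<theta> s)) (at s)" for s
  proof -
    have "(\<theta> has_real_derivative 1 / (1 / g (\<theta> s))) (at (T (\<theta> s)))"
    proof (rule has_real_derivative_local_inverse[where S = "{a<..<b}" and f = T])
      show "(T has_real_derivative 1 / g (\<theta> s)) (at (\<theta> s))"
        using T \<theta>_in[of s] by simp
      show "1 / g (\<theta> s) \<noteq> 0"
        using assms(2)[of "\<theta> s"] \<theta>_in[of s] by simp
      show "T differentiable (at y)" if "y \<in> {a<..<b}" for y
        using T that by (auto simp: real_differentiable_def)
    qed (use \<theta>_T \<theta>_in in auto)
    then show ?thesis
      by (simp add: T_\<theta>)
  qed
  have \<theta>_less: "\<theta> s < \<theta> t" if "s < t" for s t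
  proof (rule ccontr)
    assume "\<not> \<theta> s < \<theta> t"
    then have "T (\<theta> t) \<le> T (\<theta> s)"
      using T_less[of "\<theta> t" "\<theta> s"] \<theta>_in[of s] \<theta>_in[of t] by (cases "\<theta> t = \<theta> s") auto
    then show False
      using that by (simp add: T_\<theta>)
  qed
  have "(\<theta> \<longlongrightarrow> b) at_top"
  proof (rule order_tendstoI)
    fix y assume "y < b"
    \<comment> \<open>\<open>\<theta>\<close> is increasing and takes the value \<open>m\<close> at
      time \<open>T m\<close>, so it stays above \<open>y\<close> afterwards. The midpoint enters
      because \<open>y\<close> may lie to the left of \<open>a\<close>.\<close>
    define m where "m = max y ((a + b) / 2)"
    have m: "m \<in> {a<..<b}" "y \<le> m"
      using assms(1) \<open>y < b\<close> by (auto simp: m_def max_def field_simps)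
    show "\<forall>\<^sub>F s in at_top. y < \<theta> s"
      using eventually_gt_at_top[of "T m"]
    proof eventually_elim
      case (elim s)
      then show ?case
        using \<theta>_less[OF elim] \<theta>_T[OF m(1)] m(2) by simp
    qed
  next
    fix y assume "b < y"
    then have "\<theta> s < y" for s
      using \<theta>_in[of s] by simp
    then show "\<forall>\<^sub>F s in at_top. \<theta> s < y"
      by simp
  qed
  moreover have "(\<theta> \<longlongrightarrow> a) at_bot"
  proof (rule order_tendstoI)
    fix y assume "a < y"
    define m where "m = min y ((a + b) / 2)"
    have m: "m \<in> {a<..<b}" "m \<le> y"
      using assms(1) \<open>a < y\<close> by (auto simp: m_def min_def field_simps)
    show "\<forall>\<^sub>F s in at_bot. \<theta> s < y"
      using eventually_gt_at_bot[of "T m"]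
    proof eventually_elim
      case (elim s)
      then show ?case
        using \<theta>_less[OF elim] \<theta>_T[OF m(1)] m(2) by simp
    qed
  next
    fix y assume "y < a"
    then have "y < \<theta> s" for s
      using \<theta>_in[of s] by simp
    then show "\<forall>\<^sub>F s in at_bot. y < \<theta> s"
      by simp
  qed
  moreover have "range \<theta> \<subseteq> {a<..<b}"
    using \<theta>_in by blast
  ultimately show thesis
    using that[OF \<theta>'] by blast
qed

section \<open>Minkowski geometry\<close>

lemma UNIV_4_from_0: "UNIV = {0, 1, 2, 3 :: 4}"
  using index_cases by blast

lemma sum_UNIV_4: "(\<Sum>i\<in>UNIV. f (i::4)) = f 0 + f 1 + f 2 + (f 3 :: 'a::comm_monoid_add)"
  unfolding UNIV_4_from_0 by (simp add: add.assoc)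

lemma vec_eq_4_iff:
  "x = (y :: 'a^4) \<longleftrightarrow> x $ 0 = y $ 0 \<and> x $ 1 = y $ 1 \<and> x $ 2 = y $ 2 \<and> x $ 3 = y $ 3"
  unfolding vec_eq_iff using index_cases by metis

lemma mink_component: "mink $ \<alpha> $ \<beta> = (if \<alpha> = \<beta> then (if \<alpha> = 0 then - 1 else 1) else 0)"
  by (simp add: mink_def)

lemma mink_mult_component: "(mink *v x) $ \<alpha> = (if \<alpha> = 0 then - x $ \<alpha> else x $ \<alpha>)"
  using index_cases[of \<alpha>] by (auto simp: matrix_vector_mult_def sum_UNIV_4 mink_component)

lemma mink_mult_mink_mult: "mink *v (mink *v x) = x"
  by (simp add: vec_eq_iff mink_mult_component)

lemma mink_mult_axis_component: "(mink *v axis \<gamma> 1) $ \<alpha> = mink $ \<alpha> $ \<gamma>"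
  by (auto simp: mink_mult_component mink_component axis_def)

lemma mprod_commute: "mprod x y = mprod y x"
  by (simp add: mprod_expand)

lemma mprod_add_left: "mprod (x + y) z = mprod x z + mprod y z"
  and mprod_add_right: "mprod z (x + y) = mprod z x + mprod z y"
  and mprod_diff_left: "mprod (x - y) z = mprod x z - mprod y z"
  and mprod_diff_right: "mprod z (x - y) = mprod z x - mprod z y"
  and mprod_scaleR_left: "mprod (c *\<^sub>R x) z = c * mprod x z"
  and mprod_scaleR_right: "mprod z (c *\<^sub>R x) = c * mprod z x"
  by (simp_all add: mprod_expand algebra_simps)

lemmas mprod_linear = mprod_add_left mprod_add_right mprod_diff_left mprod_diff_right
  mprod_scaleR_left mprod_scaleR_right

lemma mprod_mink_mult_left: "mprod (mink *v x) y = (\<Sum>\<beta>\<in>UNIV. x $ \<beta> * y $ \<beta>)"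
  by (simp add: mprod_expand mink_mult_component sum_UNIV_4)

lemma mprod_mink_mult: "mprod (mink *v x) (mink *v y) = mprod x y"
  by (simp add: mprod_expand mink_mult_component)

text \<open>Lagrange's identity bounds the square of the spatial product by the product of the
  squared spatial norms, and for timelike vectors each of these is smaller than the squared time
  component.\<close>

lemma mprod_timelike_neg:
  assumes "x $ 0 > 0" "mprod x x < 0" "y $ 0 > 0" "mprod y y < 0"
  shows "mprod x y < 0"
proof -
  let ?a = "x $ 1" and ?b = "x $ 2" and ?c = "x $ 3" and ?d = "y $ 1" and ?e = "y $ 2" and ?f = "y $ 3"
  have x: "?a\<^sup>2 + ?b\<^sup>2 + ?c\<^sup>2 < (x $ 0)\<^sup>2" and y: "?d\<^sup>2 + ?e\<^sup>2 + ?f\<^sup>2 < (y $ 0)\<^sup>2"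
    using assms(2,4) by (simp_all add: mprod_expand power2_eq_square)
  have "(?a\<^sup>2 + ?b\<^sup>2 + ?c\<^sup>2) * (?d\<^sup>2 + ?e\<^sup>2 + ?f\<^sup>2) - (?a * ?d + ?b * ?e + ?c * ?f)\<^sup>2
      = (?a * ?e - ?b * ?d)\<^sup>2 + (?a * ?f - ?c * ?d)\<^sup>2 + (?b * ?f - ?c * ?e)\<^sup>2"
    by (simp add: power2_eq_square algebra_simps)
  then have "(?a * ?d + ?b * ?e + ?c * ?f)\<^sup>2 \<le> (?a\<^sup>2 + ?b\<^sup>2 + ?c\<^sup>2) * (?d\<^sup>2 + ?e\<^sup>2 + ?f\<^sup>2)"
    using sum_power2_ge_zero[of "?a * ?e - ?b * ?d" "?a * ?f - ?c * ?d"]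
      zero_le_power2[of "?b * ?f - ?c * ?e"] by linarith
  also have "\<dots> < (x $ 0)\<^sup>2 * (y $ 0)\<^sup>2"
    using x y by (intro mult_strict_mono') auto
  finally have "(?a * ?d + ?b * ?e + ?c * ?f)\<^sup>2 < (x $ 0 * y $ 0)\<^sup>2"
    by (simp only: power_mult_distrib)
  then have "?a * ?d + ?b * ?e + ?c * ?f < x $ 0 * y $ 0"
    by (rule power2_less_imp_less) (use assms(1,3) in simp)
  then show ?thesis
    by (simp add: mprod_expand)
qed

text \<open>If \<open>y\<close> were past-directed, \<open>mprod_timelike_neg\<close> would apply to
  \<open>- y\<close> and give the product with \<open>x\<close> the wrong sign. A vanishing time
  component is impossible for a timelike vector.\<close>

lemma timelike_future:
  assumes "x $ 0 > 0" "mprod x x < 0" "mprod y y < 0" "mprod x y < 0"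
  shows "y $ 0 > 0"
proof (rule ccontr)
  assume "\<not> y $ 0 > 0"
  moreover have "y $ 0 \<noteq> 0"
  proof
    assume "y $ 0 = 0"
    then have "mprod y y = (y $ 1)\<^sup>2 + (y $ 2)\<^sup>2 + (y $ 3)\<^sup>2"
      by (simp add: mprod_expand power2_eq_square)
    then show False
      using assms(3) by (smt (verit) zero_le_power2)
  qed
  ultimately have "(- y) $ 0 > 0"
    by simp
  moreover have "mprod (- y) (- y) < 0"
    using assms(3) by (simp add: mprod_expand)
  ultimately have "mprod x (- y) < 0"
    by (rule mprod_timelike_neg[OF assms(1,2)])
  then show False
    using assms(4) by (simp add: mprod_expand)
qed

section \<open>Temperature and velocity as coordinates of a state\<close>

lemma temp_pos: "\<psi> \<in> states \<Longrightarrow> temp \<psi> > 0"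
  by (simp add: states_def temp_def)

lemma mprod_self_eq_temp: "\<psi> \<in> states \<Longrightarrow> mprod \<psi> \<psi> = - 1 / (temp \<psi>)\<^sup>2"
  by (simp add: states_def temp_def power_divide)

lemma mprod_velocity: "\<psi> \<in> states \<Longrightarrow> mprod (velocity \<psi>) (velocity \<psi>) = - 1"
  using temp_pos[of \<psi>]
  by (simp add: velocity_def mprod_linear mprod_self_eq_temp power2_eq_square)

lemma velocity_future: "\<psi> \<in> states \<Longrightarrow> velocity \<psi> $ 0 > 0"
  using temp_pos[of \<psi>] by (simp add: velocity_def states_def)

lemma state_eq_velocity: "\<psi> \<in> states \<Longrightarrow> \<psi> = (1 / temp \<psi>) *\<^sub>R velocity \<psi>"
  using temp_pos[of \<psi>] by (simp add: velocity_def)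

lemma
  assumes "V $ 0 > 0" "mprod V V = - 1" "\<theta> > 0"
  shows scaled_velocity_in_states: "(1 / \<theta>) *\<^sub>R V \<in> states"
    and temp_scaled_velocity: "temp ((1 / \<theta>) *\<^sub>R V) = \<theta>"
    and velocity_scaled_velocity: "velocity ((1 / \<theta>) *\<^sub>R V) = V"
proof -
  have 1: "mprod ((1 / \<theta>) *\<^sub>R V) ((1 / \<theta>) *\<^sub>R V) = - 1 / \<theta>\<^sup>2"
    using assms(2) by (simp add: mprod_linear power2_eq_square)
  then show "(1 / \<theta>) *\<^sub>R V \<in> states"
    using assms by (simp add: states_def)
  show "temp ((1 / \<theta>) *\<^sub>R V) = \<theta>"
    unfolding temp_def 1 using assms by (simp add: real_sqrt_divide)
  then show "velocity ((1 / \<theta>) *\<^sub>R V) = V"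
    using assms by (simp add: velocity_def)
qed

lemma open_states: "open states"
proof -
  have states_eq: "states = {\<psi>. 0 < \<psi> $ 0} \<inter> {\<psi>. mprod \<psi> \<psi> < 0}"
    by (auto simp: states_def)
  show ?thesis
    unfolding states_eq mprod_expand by (intro open_Int open_Collect_less continuous_intros)
qed

lemma has_real_derivative_temp:
  assumes "\<psi> \<in> states"
  shows "((\<lambda>h. temp (\<psi> + h *\<^sub>R (mink *v axis \<gamma> 1))) has_real_derivative
    temp \<psi> ^ 3 * \<psi> $ \<gamma>) (at 0)"
proof -
  define c where "c = mprod \<psi> \<psi>"
  have c: "c < 0"
    using assms(1) by (simp add: c_def states_def)
  have sq: "temp (\<psi> + h *\<^sub>R (mink *v axis \<gamma> 1))
      = 1 / sqrt (- (c + 2 * h * \<psi> $ \<gamma> + h\<^sup>2 * mink $ \<gamma> $ \<gamma>))" for h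
    unfolding temp_def c_def mprod_expand using index_cases[of \<gamma>]
    by (elim disjE)
      (simp_all add: mink_mult_axis_component mink_component power2_eq_square algebra_simps)
  have t: "temp \<psi> = 1 / sqrt (- c)"
    by (simp add: temp_def c_def)
  show ?thesis
    unfolding sq t using c
    by (auto intro!: derivative_eq_intros simp: power3_eq_cube divide_simps)
qed

text \<open>The inner derivative in the causality condition is computed on \<open>states\<close>
  only; as \<open>states\<close> is open, small increments do not leave it.\<close>

lemma pd_lower_cong:
  assumes "\<psi> \<in> states" "\<And>\<phi>. \<phi> \<in> states \<Longrightarrow> f \<phi> = g \<phi>"
  shows "pd_lower \<gamma> f \<psi> = pd_lower \<gamma> g \<psi>"
proof -
  have "((\<lambda>h. \<psi> + h *\<^sub>R (mink *v axis \<gamma> 1)) \<longlongrightarrow> \<psi> + 0 *\<^sub>R (mink *v axis \<gamma> 1)) (nhds 0)"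
    by (intro tendsto_intros filterlim_ident)
  then have "\<forall>\<^sub>F h in nhds 0. \<psi> + h *\<^sub>R (mink *v axis \<gamma> 1) \<in> states"
    using open_states assms(1) by (intro topological_tendstoD) auto
  then have "\<forall>\<^sub>F h in nhds 0. f (\<psi> + h *\<^sub>R (mink *v axis \<gamma> 1)) = g (\<psi> + h *\<^sub>R (mink *v axis \<gamma> 1))"
    by eventually_elim (rule assms(2))
  then show ?thesis
    unfolding pd_lower_def by (intro deriv_cong_ev) auto
qed

section \<open>Causal barotropic fluids\<close>

locale causal_fluid =
  fixes p :: "real \<Rightarrow> real"
  assumes smooth: "smooth_on {0<..} p"
    and causal: "strictly_causal p"
begin

lemma smooth_deriv: "smooth_on {0<..} (deriv p)"
  and smooth_deriv2: "smooth_on {0<..} (deriv (deriv p))"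
  by (intro smooth_on_deriv smooth open_greaterThan)+

lemma DERIV_p: "\<theta> > 0 \<Longrightarrow> (p has_real_derivative deriv p \<theta>) (at \<theta>)"
  and DERIV_p': "\<theta> > 0 \<Longrightarrow> (deriv p has_real_derivative deriv (deriv p) \<theta>) (at \<theta>)"
  using smooth smooth_deriv
  by (auto intro: smooth_on_has_real_derivative)

text \<open>\<open>third_moment\<close> is the totally symmetric tensor
  \<open>\<partial>\<^sup>2(p \<psi>\<^sup>\<beta>)/\<partial>\<psi>\<^sub>\<alpha>\<partial>\<psi>\<^sub>\<gamma>\<close>.\<close>

definition third_moment :: "real^4 \<Rightarrow> 4 \<Rightarrow> 4 \<Rightarrow> 4 \<Rightarrow> real" where
  "third_moment \<psi> \<alpha> \<beta> \<gamma> =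
     temp \<psi> ^ 5 * (3 * deriv p (temp \<psi>) + temp \<psi> * deriv (deriv p) (temp \<psi>))
       * \<psi> $ \<alpha> * \<psi> $ \<beta> * \<psi> $ \<gamma>
     + temp \<psi> ^ 3 * deriv p (temp \<psi>)
       * (mink $ \<alpha> $ \<gamma> * \<psi> $ \<beta> + mink $ \<beta> $ \<gamma> * \<psi> $ \<alpha> + mink $ \<alpha> $ \<beta> * \<psi> $ \<gamma>)"

lemma pd_lower_energy_momentum:
  assumes "\<psi> \<in> states"
  shows "pd_lower \<gamma> (\<lambda>\<phi>. energy_momentum p \<phi> \<alpha> \<beta>) \<psi> = third_moment \<psi> \<alpha> \<beta> \<gamma>"
proof -
  let ?e = "mink *v axis \<gamma> 1 :: real^4" and ?\<theta> = "temp \<psi>"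
  let ?t = "\<lambda>h. temp (\<psi> + h *\<^sub>R ?e)"
  note t = has_real_derivative_temp[OF assms, of \<gamma>]
  have p: "((\<lambda>h. p (?t h)) has_real_derivative deriv p ?\<theta> * (?\<theta> ^ 3 * \<psi> $ \<gamma>)) (at 0)"
    and p': "((\<lambda>h. deriv p (?t h)) has_real_derivative
      deriv (deriv p) ?\<theta> * (?\<theta> ^ 3 * \<psi> $ \<gamma>)) (at 0)"
    using DERIV_chain2[OF _ t, of p] DERIV_chain2[OF _ t, of "deriv p"]
      DERIV_p[OF temp_pos[OF assms]] DERIV_p'[OF temp_pos[OF assms]] by simp_all
  have c: "((\<lambda>h. (\<psi> + h *\<^sub>R ?e) $ \<delta>) has_real_derivative mink $ \<delta> $ \<gamma>) (at 0)" for \<delta>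
    by (auto intro!: derivative_eq_intros simp: mink_mult_axis_component)
  have "((\<lambda>h. energy_momentum p (\<psi> + h *\<^sub>R ?e) \<alpha> \<beta>) has_real_derivative
      third_moment \<psi> \<alpha> \<beta> \<gamma>) (at 0)"
    unfolding energy_momentum_def third_moment_def
    by (rule derivative_eq_intros p p' t c refl)+
      (simp add: power_numeral_reduce algebra_simps)
  then show ?thesis
    by (simp add: pd_lower_def DERIV_imp_deriv)
qed

lemma pd_lower_pd_lower:
  assumes "\<psi> \<in> states"
  shows "pd_lower \<alpha> (pd_lower \<gamma> (\<lambda>\<phi>. p (temp \<phi>) * \<phi> $ \<beta>)) \<psi> = third_moment \<psi> \<alpha> \<beta> \<gamma>"
proof -
  have "pd_lower \<gamma> (\<lambda>\<phi>. p (temp \<phi>) * \<phi> $ \<beta>) \<phi> = energy_momentum p \<phi> \<gamma> \<beta>" if "\<phi> \<in> states" for \<phi>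
    using energy_momentum_eq_pd_lower[OF that] smooth_on_imp_differentiable[OF smooth]
      temp_pos[OF that] by simp
  then have "pd_lower \<alpha> (pd_lower \<gamma> (\<lambda>\<phi>. p (temp \<phi>) * \<phi> $ \<beta>)) \<psi> =
      pd_lower \<alpha> (\<lambda>\<phi>. energy_momentum p \<phi> \<gamma> \<beta>) \<psi>"
    by (intro pd_lower_cong assms)
  also have "\<dots> = third_moment \<psi> \<alpha> \<beta> \<gamma>"
    unfolding pd_lower_energy_momentum[OF assms]
    by (simp add: third_moment_def mink_component algebra_simps)
  finally show ?thesis .
qed

text \<open>Strict causality in the rest frame, for the vector \<open>(1, t, 0, 0)\<close> and the test
  vector \<open>(a, b, 0, 0)\<close>.\<close>

lemma causality_rest_frame:
  assumes "\<theta> > 0" "\<bar>t\<bar> \<le> 1" "a \<noteq> 0 \<or> b \<noteq> 0"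
  shows "deriv p \<theta> * (2 * t * a * b - b\<^sup>2) < \<theta> * deriv (deriv p) \<theta> * a\<^sup>2"
proof -
  define V :: "real^4" where "V = axis 0 1"
  define \<psi> where "\<psi> = (1 / \<theta>) *\<^sub>R V"
  define T :: "real^4" where "T = axis 0 1 + t *\<^sub>R axis 1 1"
  define v :: "real^4" where "v = axis 0 a + axis 1 b"
  have V: "V $ 0 > 0" "mprod V V = - 1"
    by (simp_all add: V_def mprod_expand axis_def)
  note \<psi> = scaled_velocity_in_states[OF V assms(1), folded \<psi>_def]
    temp_scaled_velocity[OF V assms(1), folded \<psi>_def]
  define A :: "real^4^4" where "A = (\<chi> \<alpha> \<gamma>. \<Sum>\<beta>\<in>UNIV.
    pd_lower \<alpha> (pd_lower \<gamma> (\<lambda>\<phi>. p (temp \<phi>) * \<phi> $ \<beta>)) \<psi> * (mink *v T) $ \<beta>)"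
  have A: "A $ \<alpha> $ \<gamma> = (\<Sum>\<beta>\<in>UNIV. third_moment \<psi> \<alpha> \<beta> \<gamma> * (mink *v T) $ \<beta>)" for \<alpha> \<gamma>
    by (simp add: A_def pd_lower_pd_lower[OF \<psi>(1)])
  have "t * t \<le> 1"
    using assms(2) abs_square_le_1[of t] by (simp add: power2_eq_square)
  then have "T $ 0 > 0 \<and> mprod T T \<le> 0"
    by (simp add: T_def mprod_expand axis_def)
  then have "negative_definite A"
    using causal \<psi>(1) unfolding strictly_causal_def A_def by blast
  moreover have "v \<noteq> 0"
    using assms(3) by (auto simp: v_def vec_eq_4_iff axis_def)
  ultimately have "v \<bullet> (A *v v) < 0"
    by (simp add: negative_definite_def)
  moreover have "v \<bullet> (A *v v) = v $ 0 * (A $ 0 $ 0 * v $ 0 + A $ 0 $ 1 * v $ 1)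
      + v $ 1 * (A $ 1 $ 0 * v $ 0 + A $ 1 $ 1 * v $ 1)"
    by (simp add: inner_vec_def matrix_vector_mult_def sum_UNIV_4 v_def axis_def)
  moreover have \<psi>_comp: "\<psi> $ 0 = 1 / \<theta>" "\<psi> $ 1 = 0" "\<psi> $ 2 = 0" "\<psi> $ 3 = 0"
    by (simp_all add: \<psi>_def V_def axis_def)
  moreover have "A $ 0 $ 0 = \<theta>\<^sup>2 * (- (\<theta> * deriv (deriv p) \<theta>))"
    "A $ 0 $ 1 = \<theta>\<^sup>2 * (t * deriv p \<theta>)" "A $ 1 $ 0 = \<theta>\<^sup>2 * (t * deriv p \<theta>)"
    "A $ 1 $ 1 = \<theta>\<^sup>2 * (- deriv p \<theta>)"
    using assms(1)
    by (simp_all add: A third_moment_def \<psi>(2) \<psi>_comp sum_UNIV_4 T_def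
        mink_mult_component mink_component axis_def power_numeral_reduce field_simps)
  moreover have "v $ 0 = a" "v $ 1 = b"
    by (simp_all add: v_def axis_def)
  ultimately have "\<theta>\<^sup>2 * (deriv p \<theta> * (2 * t * a * b - b\<^sup>2) - \<theta> * deriv (deriv p) \<theta> * a\<^sup>2) < 0"
    by (simp add: power2_eq_square algebra_simps)
  then show ?thesis
    using assms(1) by (simp add: mult_less_0_iff)
qed

text \<open>The three sign conditions come from \<open>T\<close> at rest with a purely spatial or a
  purely temporal test vector, and from the null vector \<open>t = 1\<close> with
  \<open>a = b\<close>. The last one says that sound is slower than light.\<close>

lemma p'_pos: "\<theta> > 0 \<Longrightarrow> deriv p \<theta> > 0"
  using causality_rest_frame[of \<theta> 0 0 1] by simp

lemma p''_pos: "\<theta> > 0 \<Longrightarrow> deriv (deriv p) \<theta> > 0"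
  using causality_rest_frame[of \<theta> 0 1 0] by (simp add: zero_less_mult_iff)

lemma p'_less: "\<theta> > 0 \<Longrightarrow> deriv p \<theta> < \<theta> * deriv (deriv p) \<theta>"
  using causality_rest_frame[of \<theta> 1 1 1] by simp

section \<open>Energy density as a coordinate in place of the temperature\<close>

lemma DERIV_energy_density:
  "\<theta> > 0 \<Longrightarrow> (energy_density p has_real_derivative \<theta> * deriv (deriv p) \<theta>) (at \<theta>)"
  unfolding energy_density_def[abs_def]
  by (rule derivative_eq_intros DERIV_p DERIV_p' refl | assumption)+ simp

lemma energy_density_strict_mono:
  assumes "0 < \<theta>" "\<theta> < \<theta>'"
  shows "energy_density p \<theta> < energy_density p \<theta>'"
proof (rule DERIV_pos_imp_increasing[OF assms(2)])
  fix t assume "\<theta> \<le> t" "t \<le> \<theta>'"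
  then show "\<exists>y. (energy_density p has_real_derivative y) (at t) \<and> 0 < y"
    using DERIV_energy_density[of t] p''_pos[of t] assms(1) by (intro exI[of _ "t * deriv (deriv p) t"]) auto
qed

definition temp_of_density :: "real \<Rightarrow> real" where
  "temp_of_density \<rho> = (THE \<theta>. \<theta> > 0 \<and> energy_density p \<theta> = \<rho>)"

lemma temp_of_density: "\<theta> > 0 \<Longrightarrow> temp_of_density (energy_density p \<theta>) = \<theta>"
  unfolding temp_of_density_def
  using energy_density_strict_mono by (intro the_equality) (auto, metis less_irrefl linorder_neqE_linordered_idom)

lemma pressure_of_density: "\<theta> > 0 \<Longrightarrow> pressure_of_density p (energy_density p \<theta>) = p \<theta>"
  unfolding pressure_of_density_def using temp_of_density by (simp add: temp_of_density_def)

lemma DERIV_temp_of_density: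
  assumes "\<theta> > 0"
  shows "(temp_of_density has_real_derivative 1 / (\<theta> * deriv (deriv p) \<theta>)) (at (energy_density p \<theta>))"
  by (rule has_real_derivative_local_inverse[where S = "{0<..}"])
    (use assms p''_pos[OF assms] temp_of_density DERIV_energy_density
      in \<open>auto simp: real_differentiable_def\<close>)

text \<open>The chain rule along \<open>temp_of_density\<close>. Invariance of domain makes the
  image of \<open>energy_density p\<close> open, so that \<open>F\<close> and the composite agree
  near the point. \<open>F\<close> is general because the lemma is applied first to the pressure and
  then to its derivative.\<close>

lemma deriv_comp_temp_of_density:
  assumes "\<theta> > 0" "(f has_real_derivative D) (at \<theta>)"
    and "\<And>\<theta>. \<theta> > 0 \<Longrightarrow> F (energy_density p \<theta>) = f \<theta>"
  shows "deriv F (energy_density p \<theta>) = D / (\<theta> * deriv (deriv p) \<theta>)"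
proof -
  have "((\<lambda>\<rho>. f (temp_of_density \<rho>)) has_real_derivative D * (1 / (\<theta> * deriv (deriv p) \<theta>)))
      (at (energy_density p \<theta>))"
    by (rule DERIV_chain2[OF _ DERIV_temp_of_density[OF assms(1)]])
      (use temp_of_density[OF assms(1)] assms(2) in simp)
  moreover have "open (energy_density p ` {0<..})"
    using DERIV_energy_density
    by (intro invariance_of_domain continuous_at_imp_continuous_on ballI inj_onI)
      (auto intro: DERIV_isCont, metis temp_of_density)
  ultimately have "(F has_real_derivative D * (1 / (\<theta> * deriv (deriv p) \<theta>)))
      (at (energy_density p \<theta>))"
    by (rule has_field_derivative_transform_within_open)
      (use assms(1,3) temp_of_density in auto)
  then show ?thesis
    by (simp add: DERIV_imp_deriv)
qed

text \<open>\<open>dp/d\<rho>\<close> with both differentials taken with respect to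
  \<open>\<theta>\<close>: the squared sound speed as a function of the temperature.\<close>

definition csq :: "real \<Rightarrow> real" where
  "csq \<theta> = deriv p \<theta> / (\<theta> * deriv (deriv p) \<theta>)"

lemma csq_pos: "\<theta> > 0 \<Longrightarrow> csq \<theta> > 0"
  using p'_pos p''_pos by (simp add: csq_def)

lemma csq_less_1: "\<theta> > 0 \<Longrightarrow> csq \<theta> < 1"
  using p'_less p''_pos by (simp add: csq_def)

lemma deriv_pressure_of_density:
  "\<theta> > 0 \<Longrightarrow> deriv (pressure_of_density p) (energy_density p \<theta>) = csq \<theta>"
  unfolding csq_def by (rule deriv_comp_temp_of_density[OF _ DERIV_p pressure_of_density])

lemma sound_speed_sq: "\<theta> > 0 \<Longrightarrow> sound_speed_sq p \<theta> = csq \<theta>"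
  by (simp add: sound_speed_sq_def deriv_pressure_of_density)

lemma smooth_csq: "smooth_on {0<..} csq"
proof -
  have "smooth_on {0<..} (\<lambda>\<theta>. deriv p \<theta> * inverse (\<theta> * deriv (deriv p) \<theta>))"
    using p''_pos
    by (intro smooth_on_mult smooth_on_inverse smooth_on_ident smooth_deriv smooth_deriv2) auto
  then show ?thesis
    by (simp add: csq_def[abs_def] divide_inverse)
qed

lemma DERIV_csq: "\<theta> > 0 \<Longrightarrow> (csq has_real_derivative deriv csq \<theta>) (at \<theta>)"
  using smooth_csq by (auto intro: smooth_on_has_real_derivative)

lemma genuine_nonlinearity:
  assumes "genuinely_nonlinear p" "\<theta> > 0"
  shows "\<theta> * deriv p \<theta> * (deriv csq \<theta> / (\<theta> * deriv (deriv p) \<theta>)) + 2 * (1 - csq \<theta>) * csq \<theta> > 0"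
proof -
  have "deriv (deriv (pressure_of_density p)) (energy_density p \<theta>)
      = deriv csq \<theta> / (\<theta> * deriv (deriv p) \<theta>)"
    using DERIV_csq deriv_pressure_of_density assms(2) by (intro deriv_comp_temp_of_density) auto
  moreover have "energy_density p \<theta> + pressure_of_density p (energy_density p \<theta>) = \<theta> * deriv p \<theta>"
    using assms(2) by (simp add: pressure_of_density) (simp add: energy_density_def)
  ultimately show ?thesis
    using assms deriv_pressure_of_density[OF assms(2)]
    unfolding genuinely_nonlinear_def by (metis greaterThan_iff image_eqI)
qed

end

section \<open>Flux and dissipation in a direction\<close>

text \<open>The flux in the form \<open>(\<rho> + p) v U + p X\<close>: the factor
  \<open>temp \<psi> * deriv p (temp \<psi>)\<close> is the enthalpy density
  \<open>\<rho> + p\<close>.\<close>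

lemma normal_flux_eq:
  "normal_flux p \<xi> \<psi> \<alpha> =
    temp \<psi> * deriv p (temp \<psi>) * mprod (mink *v \<xi>) (velocity \<psi>) * velocity \<psi> $ \<alpha>
      + p (temp \<psi>) * (mink *v \<xi>) $ \<alpha>"
proof -
  have "normal_flux p \<xi> \<psi> \<alpha> = temp \<psi> * deriv p (temp \<psi>)
        * (\<Sum>\<beta>\<in>UNIV. \<xi> $ \<beta> * velocity \<psi> $ \<beta>) * velocity \<psi> $ \<alpha>
      + p (temp \<psi>) * (\<Sum>\<beta>\<in>UNIV. \<xi> $ \<beta> * mink $ \<alpha> $ \<beta>)"
    unfolding normal_flux_def energy_momentum_def sum_UNIV_4
    by (simp add: velocity_def power3_eq_cube algebra_simps)
  also have "(\<Sum>\<beta>\<in>UNIV. \<xi> $ \<beta> * mink $ \<alpha> $ \<beta>) = (mink *v \<xi>) $ \<alpha>"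
    by (simp add: matrix_vector_mult_def mult.commute)
  finally show ?thesis
    by (simp only: mprod_mink_mult_left)
qed

lemma projector_sum: "(\<Sum>\<gamma>\<in>UNIV. projector \<psi> \<alpha> \<gamma> * x $ \<gamma>) =
    (mink *v x) $ \<alpha> + velocity \<psi> $ \<alpha> * mprod (velocity \<psi>) (mink *v x)"
  using index_cases[of \<alpha>]
  by (auto simp: projector_def sum_UNIV_4 mink_component mink_mult_component mprod_expand algebra_simps)

lemma projector_idempotent:
  assumes "\<psi> \<in> states"
  shows "(\<Sum>\<gamma>\<in>UNIV. \<Sum>\<delta>\<in>UNIV. projector \<psi> \<alpha> \<gamma> * projector \<psi> \<beta> \<delta> * mink $ \<gamma> $ \<delta>)
    = projector \<psi> \<alpha> \<beta>"
proof -
  let ?U = "velocity \<psi>"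
  let ?P = "\<chi> \<delta>. projector \<psi> \<beta> \<delta>"
  have P: "?P = mink *v axis \<beta> 1 + ?U $ \<beta> *\<^sub>R ?U"
    by (simp add: vec_eq_iff projector_def mink_mult_axis_component) (simp add: mink_component)
  have "mprod ?U (mink *v axis \<beta> 1) = ?U $ \<beta>"
    using index_cases[of \<beta>] by (auto simp: mprod_expand mink_mult_component axis_def)
  then have "mprod ?U ?P = 0"
    unfolding P by (simp add: mprod_linear mprod_velocity[OF assms])
  moreover have "(\<Sum>\<delta>\<in>UNIV. projector \<psi> \<beta> \<delta> * mink $ \<gamma> $ \<delta>) = (mink *v ?P) $ \<gamma>" for \<gamma>
    by (simp add: matrix_vector_mult_def mult.commute)
  then have "(\<Sum>\<gamma>\<in>UNIV. \<Sum>\<delta>\<in>UNIV. projector \<psi> \<alpha> \<gamma> * projector \<psi> \<beta> \<delta> * mink $ \<gamma> $ \<delta>)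
      = (\<Sum>\<gamma>\<in>UNIV. projector \<psi> \<alpha> \<gamma> * (mink *v ?P) $ \<gamma>)"
    by (simp add: mult.assoc sum_distrib_left[symmetric])
  ultimately show ?thesis
    by (simp add: projector_sum mink_mult_mink_mult) (simp add: projector_def mink_component mult.commute)
qed

text \<open>In the absence of heat conduction the coefficients \<open>\<sigma>\<close> and \<open>\<zeta>'\<close> combine in such a way that
  the dissipative flux is just \<open>\<sigma> U'\<close>. The assumption on \<open>D = U'\<close> says that \<open>U\<close> varies in the
  plane spanned by \<open>U\<close> and \<open>\<xi>\<close>.\<close>

lemma dissipation_in_plane:
  assumes "\<psi> \<in> states" "sound_speed_sq p (temp \<psi>) \<noteq> 1"
    and v: "v = mprod (mink *v \<xi>) (velocity \<psi>)"
    and d: "d = mprod (mink *v \<xi>) D"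
    and UD: "mprod (velocity \<psi>) D = 0"
    and D: "(1 + v\<^sup>2) *\<^sub>R D = d *\<^sub>R (mink *v \<xi> + v *\<^sub>R velocity \<psi>)"
    and X: "mprod \<xi> \<xi> = 1"
  shows "- (\<Sum>\<beta>\<in>UNIV. \<xi> $ \<beta> *
      dissipation_tensor p \<eta> \<zeta> (\<lambda>\<psi>. 0) \<psi> (\<lambda>\<gamma> \<delta>. \<xi> $ \<delta> * D $ \<gamma>) d\<theta> \<alpha> \<beta>)
    = (4/3 * \<eta> \<psi> + \<zeta> \<psi>) / (1 - sound_speed_sq p (temp \<psi>)) * D $ \<alpha>"
proof -
  define U where "U = velocity \<psi>"
  define c2 where "c2 = sound_speed_sq p (temp \<psi>)"
  define \<sigma> where "\<sigma> = (4/3 * \<eta> \<psi> + \<zeta> \<psi>) / (1 - c2)"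
  \<comment> \<open>The normal projected orthogonally to \<open>U\<close>; the assumption on
    \<open>D\<close> makes \<open>D\<close> a multiple of it.\<close>
  define Y where "Y = mink *v \<xi> + v *\<^sub>R U"
  define P where "P = projector \<psi>"
  define l where "l = mink *v D"
  have ml: "mink *v l = D"
    by (simp add: l_def mink_mult_mink_mult)
  have PD: "(\<Sum>\<gamma>\<in>UNIV. P \<alpha> \<gamma> * l $ \<gamma>) = D $ \<alpha>" for \<alpha>
    using UD by (simp add: P_def projector_sum ml)
  have P\<xi>: "(\<Sum>\<gamma>\<in>UNIV. P \<alpha> \<gamma> * \<xi> $ \<gamma>) = Y $ \<alpha>" for \<alpha>
    by (simp add: P_def projector_sum Y_def U_def v mprod_commute)
  have P\<xi>': "(\<Sum>\<beta>\<in>UNIV. \<xi> $ \<beta> * P \<alpha> \<beta>) = Y $ \<alpha>" for \<alpha>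
    using P\<xi>[of \<alpha>] by (simp add: mult.commute)
  have \<xi>U: "(\<Sum>\<beta>\<in>UNIV. \<xi> $ \<beta> * U $ \<beta>) = v"
    and \<xi>D: "(\<Sum>\<beta>\<in>UNIV. \<xi> $ \<beta> * D $ \<beta>) = d"
    and \<xi>Y: "(\<Sum>\<beta>\<in>UNIV. \<xi> $ \<beta> * Y $ \<beta>) = 1 + v\<^sup>2"
    using X v unfolding mprod_mink_mult_left[symmetric] d Y_def U_def
    by (simp_all add: mprod_linear mprod_mink_mult power2_eq_square)
  have T: "dissipation_tensor p \<eta> \<zeta> (\<lambda>\<psi>. 0) \<psi> (\<lambda>\<gamma> \<delta>. \<xi> $ \<delta> * D $ \<gamma>) d\<theta> \<alpha> \<beta> =
      - (\<eta> \<psi> * (D $ \<alpha> * Y $ \<beta> + Y $ \<alpha> * D $ \<beta> - 2/3 * d * P \<alpha> \<beta>)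
         + (\<zeta> \<psi> + c2 * \<sigma>) * P \<alpha> \<beta> * d
         + \<sigma> * (U $ \<alpha> * U $ \<beta> * d - v * (D $ \<alpha> * U $ \<beta> + D $ \<beta> * U $ \<alpha>)))" for \<beta>
  proof -
    have l: "(\<Sum>\<epsilon>\<in>UNIV. mink $ \<gamma> $ \<epsilon> * (\<xi> $ \<delta> * D $ \<epsilon>)) = l $ \<gamma> * \<xi> $ \<delta>" for \<gamma> \<delta>
      by (simp add: l_def matrix_vector_mult_def sum_UNIV_4 algebra_simps)
    have "(\<Sum>\<gamma>\<in>UNIV. \<Sum>\<delta>\<in>UNIV. P \<alpha> \<gamma> * P \<beta> \<delta> *
        (l $ \<gamma> * \<xi> $ \<delta> + l $ \<delta> * \<xi> $ \<gamma> - 2/3 * mink $ \<gamma> $ \<delta> * d))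
      = (\<Sum>\<gamma>\<in>UNIV. P \<alpha> \<gamma> * l $ \<gamma>) * (\<Sum>\<delta>\<in>UNIV. P \<beta> \<delta> * \<xi> $ \<delta>)
        + (\<Sum>\<gamma>\<in>UNIV. P \<alpha> \<gamma> * \<xi> $ \<gamma>) * (\<Sum>\<delta>\<in>UNIV. P \<beta> \<delta> * l $ \<delta>)
        - 2/3 * d * (\<Sum>\<gamma>\<in>UNIV. \<Sum>\<delta>\<in>UNIV. P \<alpha> \<gamma> * P \<beta> \<delta> * mink $ \<gamma> $ \<delta>)"
      unfolding sum_UNIV_4 by (simp add: algebra_simps)
    then have 1: "(\<Sum>\<gamma>\<in>UNIV. \<Sum>\<delta>\<in>UNIV. P \<alpha> \<gamma> * P \<beta> \<delta> *
        (l $ \<gamma> * \<xi> $ \<delta> + l $ \<delta> * \<xi> $ \<gamma> - 2/3 * mink $ \<gamma> $ \<delta> * d))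
      = D $ \<alpha> * Y $ \<beta> + Y $ \<alpha> * D $ \<beta> - 2/3 * d * P \<alpha> \<beta>"
      unfolding PD P\<xi> projector_idempotent[OF assms(1), folded P_def] .
    have "(\<Sum>\<gamma>\<in>UNIV. \<Sum>\<delta>\<in>UNIV. (P \<alpha> \<gamma> * U $ \<beta> + P \<beta> \<gamma> * U $ \<alpha>) * U $ \<delta> * (l $ \<gamma> * \<xi> $ \<delta>))
      = (\<Sum>\<delta>\<in>UNIV. \<xi> $ \<delta> * U $ \<delta>) * ((\<Sum>\<gamma>\<in>UNIV. P \<alpha> \<gamma> * l $ \<gamma>) * U $ \<beta>
         + (\<Sum>\<gamma>\<in>UNIV. P \<beta> \<gamma> * l $ \<gamma>) * U $ \<alpha>)"
      unfolding sum_UNIV_4 by (simp add: algebra_simps)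
    then have 2: "(\<Sum>\<gamma>\<in>UNIV. \<Sum>\<delta>\<in>UNIV. (P \<alpha> \<gamma> * U $ \<beta> + P \<beta> \<gamma> * U $ \<alpha>) * U $ \<delta> * (l $ \<gamma> * \<xi> $ \<delta>))
      = v * (D $ \<alpha> * U $ \<beta> + D $ \<beta> * U $ \<alpha>)"
      by (simp only: PD \<xi>U)
    show ?thesis
      unfolding dissipation_tensor_def Let_def l P_def[symmetric] U_def[symmetric] \<xi>D 1 2
        c2_def[symmetric]
      by (simp add: \<sigma>_def)
  qed
  have "- (\<Sum>\<beta>\<in>UNIV. \<xi> $ \<beta> *
      dissipation_tensor p \<eta> \<zeta> (\<lambda>\<psi>. 0) \<psi> (\<lambda>\<gamma> \<delta>. \<xi> $ \<delta> * D $ \<gamma>) d\<theta> \<alpha> \<beta>)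
    = \<eta> \<psi> * (D $ \<alpha> * (\<Sum>\<beta>\<in>UNIV. \<xi> $ \<beta> * Y $ \<beta>) + Y $ \<alpha> * (\<Sum>\<beta>\<in>UNIV. \<xi> $ \<beta> * D $ \<beta>)
        - 2/3 * d * (\<Sum>\<beta>\<in>UNIV. \<xi> $ \<beta> * P \<alpha> \<beta>))
      + (\<zeta> \<psi> + c2 * \<sigma>) * (\<Sum>\<beta>\<in>UNIV. \<xi> $ \<beta> * P \<alpha> \<beta>) * d
      + \<sigma> * (U $ \<alpha> * (\<Sum>\<beta>\<in>UNIV. \<xi> $ \<beta> * U $ \<beta>) * d
        - v * (D $ \<alpha> * (\<Sum>\<beta>\<in>UNIV. \<xi> $ \<beta> * U $ \<beta>) + (\<Sum>\<beta>\<in>UNIV. \<xi> $ \<beta> * D $ \<beta>) * U $ \<alpha>))"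
    unfolding T sum_UNIV_4 by (simp add: algebra_simps)
  \<comment> \<open>The terms along \<open>U\<close> cancel, since \<open>d\<close> is the
    divergence as well as the normal component of \<open>D\<close>.\<close>
  also have "\<dots> = \<eta> \<psi> * (D $ \<alpha> * (1 + v\<^sup>2)) + (1/3 * \<eta> \<psi> + \<zeta> \<psi> + c2 * \<sigma>) * (d * Y $ \<alpha>)
      - \<sigma> * v\<^sup>2 * D $ \<alpha>"
    unfolding \<xi>U \<xi>D \<xi>Y P\<xi>' by (simp add: algebra_simps power2_eq_square)
  also have "d * Y $ \<alpha> = (1 + v\<^sup>2) * D $ \<alpha>"
    using arg_cong[OF D, of "\<lambda>x. x $ \<alpha>"] by (simp add: Y_def U_def)
  also have "\<eta> \<psi> * (D $ \<alpha> * (1 + v\<^sup>2)) + (1/3 * \<eta> \<psi> + \<zeta> \<psi> + c2 * \<sigma>) * ((1 + v\<^sup>2) * D $ \<alpha>)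
      - \<sigma> * v\<^sup>2 * D $ \<alpha> = ((4/3 * \<eta> \<psi> + \<zeta> \<psi> + c2 * \<sigma>) * (1 + v\<^sup>2) - \<sigma> * v\<^sup>2) * D $ \<alpha>"
    by (simp add: algebra_simps)
  \<comment> \<open>With this the coefficient of \<open>D $ \<alpha>\<close> becomes
    \<open>\<sigma> (1 + v\<^sup>2) - \<sigma> v\<^sup>2\<close>.\<close>
  also have "4/3 * \<eta> \<psi> + \<zeta> \<psi> = \<sigma> * (1 - c2)"
    using assms(2) by (simp add: \<sigma>_def c2_def)
  also have "((\<sigma> * (1 - c2) + c2 * \<sigma>) * (1 + v\<^sup>2) - \<sigma> * v\<^sup>2) * D $ \<alpha> = \<sigma> * D $ \<alpha>"
    by (simp add: algebra_simps)
  finally show ?thesis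
    by (simp add: \<sigma>_def c2_def)
qed

section \<open>Shock profiles\<close>

text \<open>The flux vector of a shock is \<open>q0 N + q1 X\<close>, where \<open>X\<close> is the spacelike unit normal \<open>\<xi>\<close> with
  its index raised and \<open>N\<close> a unit vector orthogonal to it. Since the dissipative flux is \<open>\<sigma> U'\<close>,
  the component of the profile equation along \<open>U\<close> is algebraic; it is solved by \<open>profile_velocity\<close>
  with the temperature as the parameter.\<close>

locale shock_flux = causal_fluid +
  fixes \<xi> N :: "real^4" and q0 q1 :: real
  assumes gnl: "genuinely_nonlinear p"
    and \<xi>\<xi>: "mprod \<xi> \<xi> = 1"
    and NN: "mprod N N = - 1" and N_future: "N $ 0 > 0"
    and NX: "mprod N (mink *v \<xi>) = 0"
    and q0: "q0 \<noteq> 0"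
begin

abbreviation X :: "real^4" where "X \<equiv> mink *v \<xi>"

lemma XX: "mprod X X = 1" and XN: "mprod X N = 0"
  using \<xi>\<xi> NX by (simp_all add: mprod_mink_mult mprod_commute)

definition b :: "real \<Rightarrow> real" where "b \<theta> = energy_density p \<theta> + q1"

text \<open>Minus the Minkowski square of \<open>b \<theta> *\<^sub>R N + q0 *\<^sub>R X\<close>, by
  which the velocity is normalised.\<close>

definition K :: "real \<Rightarrow> real" where "K \<theta> = b \<theta> ^ 2 - q0 ^ 2"

definition H :: "real \<Rightarrow> real" where "H \<theta> = (q1 - p \<theta>) * b \<theta> - q0 ^ 2"

definition E :: "real \<Rightarrow> real" where "E \<theta> = (q1 - p \<theta>) - csq \<theta> * b \<theta>"

text \<open>The positive temperatures at which
  \<open>b \<theta> *\<^sub>R N + q0 *\<^sub>R X\<close> is timelike and future-directed.\<close>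

definition dom :: "real set" where "dom = {\<theta>. \<theta> > 0 \<and> b \<theta> > \<bar>q0\<bar>}"

definition profile_velocity :: "real \<Rightarrow> real^4" where
  "profile_velocity \<theta> = inverse (sqrt (K \<theta>)) *\<^sub>R (b \<theta> *\<^sub>R N + q0 *\<^sub>R X)"

definition profile_state :: "real \<Rightarrow> real^4" where
  "profile_state \<theta> = (1 / \<theta>) *\<^sub>R profile_velocity \<theta>"

lemma DERIV_b: "\<theta> > 0 \<Longrightarrow> (b has_real_derivative \<theta> * deriv (deriv p) \<theta>) (at \<theta>)"
  unfolding b_def[abs_def] by (rule derivative_eq_intros DERIV_energy_density refl | assumption)+ simp

lemma b_less: "0 < \<theta> \<Longrightarrow> \<theta> < \<theta>' \<Longrightarrow> b \<theta> < b \<theta>'"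
  by (simp add: b_def energy_density_strict_mono)

lemma dom_pos: "\<theta> \<in> dom \<Longrightarrow> \<theta> > 0" and dom_b: "\<theta> \<in> dom \<Longrightarrow> b \<theta> > 0"
  by (auto simp: dom_def)

text \<open>Thanks to this the whole temperature range of a profile lies in \<open>dom\<close> as
  soon as its colder end does.\<close>

lemma dom_upward: "\<theta> \<in> dom \<Longrightarrow> \<theta> \<le> \<theta>' \<Longrightarrow> \<theta>' \<in> dom"
  using b_less[of \<theta> \<theta>'] by (cases "\<theta> = \<theta>'") (auto simp: dom_def)

lemma open_dom: "open dom"
proof -
  have "continuous_on {0<..} b"
    using DERIV_b by (meson DERIV_isCont continuous_at_imp_continuous_on greaterThan_iff)
  then have "open (b -` {\<bar>q0\<bar><..} \<inter> {0<..})"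
    by (simp add: continuous_on_open_vimage)
  moreover have "b -` {\<bar>q0\<bar><..} \<inter> {0<..} = dom"
    by (auto simp: dom_def)
  ultimately show ?thesis
    by simp
qed

lemma K_pos: "\<theta> \<in> dom \<Longrightarrow> K \<theta> > 0"
  using power_strict_mono[of "\<bar>q0\<bar>" "b \<theta>" 2] by (simp add: K_def dom_def)

lemma DERIV_K: "\<theta> > 0 \<Longrightarrow> (K has_real_derivative 2 * b \<theta> * (\<theta> * deriv (deriv p) \<theta>)) (at \<theta>)"
  unfolding K_def[abs_def] by (rule derivative_eq_intros DERIV_b refl | assumption)+ simp

lemma DERIV_H: "\<theta> > 0 \<Longrightarrow> (H has_real_derivative \<theta> * deriv (deriv p) \<theta> * E \<theta>) (at \<theta>)"
  unfolding H_def[abs_def]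
  by (rule derivative_eq_intros DERIV_b DERIV_p refl | assumption)+
    (use p''_pos[of \<theta>] in \<open>simp add: E_def csq_def field_simps\<close>)

lemma DERIV_E: "\<theta> > 0 \<Longrightarrow> (E has_real_derivative - 2 * deriv p \<theta> - deriv csq \<theta> * b \<theta>) (at \<theta>)"
  unfolding E_def[abs_def]
  by (rule derivative_eq_intros DERIV_b DERIV_p DERIV_csq refl | assumption)+
    (use p''_pos[of \<theta>] in \<open>simp add: csq_def field_simps\<close>)

text \<open>At a zero of \<open>E\<close> one has \<open>q1 - p = csq b\<close>, hence
  \<open>\<rho> + p = (1 - csq) b\<close>. Multiplying the genuine nonlinearity by
  \<open>d\<rho>/d\<theta>\<close> and substituting this turns its left-hand side into
  \<open>- (1 - csq)\<close> times the derivative of \<open>E\<close>.\<close>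

lemma E_decreasing_at_zero:
  assumes "\<theta> > 0" "E \<theta> = 0"
  shows "- 2 * deriv p \<theta> - deriv csq \<theta> * b \<theta> < 0"
proof -
  let ?e = "\<theta> * deriv (deriv p) \<theta>"
  note c = csq_pos[OF assms(1)] csq_less_1[OF assms(1)]
  have e: "?e > 0"
    using p''_pos assms(1) by simp
  have w: "\<theta> * deriv p \<theta> = (1 - csq \<theta>) * b \<theta>"
    using assms(2) by (simp add: E_def b_def energy_density_def algebra_simps)
  have "?e * (\<theta> * deriv p \<theta> * (deriv csq \<theta> / ?e) + 2 * (1 - csq \<theta>) * csq \<theta>) > 0"
    using genuine_nonlinearity[OF gnl assms(1)] e by (rule mult_pos_pos[rotated])
  also have "?e * (\<theta> * deriv p \<theta> * (deriv csq \<theta> / ?e) + 2 * (1 - csq \<theta>) * csq \<theta>)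
      = \<theta> * deriv p \<theta> * deriv csq \<theta> + 2 * (1 - csq \<theta>) * (?e * csq \<theta>)"
    using p''_pos[OF assms(1)] assms(1) by (simp add: distrib_left)
  also have "?e * csq \<theta> = deriv p \<theta>"
    using p''_pos[OF assms(1)] assms(1) by (simp add: csq_def)
  also have "\<theta> * deriv p \<theta> * deriv csq \<theta> + 2 * (1 - csq \<theta>) * deriv p \<theta>
      = (1 - csq \<theta>) * (deriv csq \<theta> * b \<theta> + 2 * deriv p \<theta>)"
    unfolding w by (simp add: algebra_simps)
  finally show ?thesis
    using c by (simp add: zero_less_mult_iff)
qed

text \<open>The zeros of \<open>H\<close> are the temperatures of the states with flux \<open>q0 N + q1 X\<close>. An interior
  minimum of \<open>H\<close> would be a zero of \<open>E\<close>, but \<open>E\<close> and hence the derivative of \<open>H\<close>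
  change from positive to negative there.\<close>

lemma H_pos_between:
  assumes "0 < a" "a < c" "H a = 0" "H c = 0" "a < \<theta>" "\<theta> < c"
  shows "H \<theta> > 0"
proof (rule ccontr)
  assume "\<not> H \<theta> > 0"
  have "continuous_on {a..c} H"
    using DERIV_H assms(1) by (meson DERIV_isCont continuous_at_imp_continuous_on atLeastAtMost_iff less_le_trans)
  then obtain m0 where m0: "m0 \<in> {a..c}" "\<And>t. t \<in> {a..c} \<Longrightarrow> H m0 \<le> H t"
    using continuous_attains_inf[of "{a..c}" H] assms(2) by auto
  \<comment> \<open>If the minimum is attained at an end, it equals \<open>0\<close>; since
    \<open>H \<theta>\<close> is not positive, \<open>\<theta>\<close> is then itself an interior
    minimum.\<close>
  obtain m where m: "a < m" "m < c" "\<And>t. t \<in> {a..c} \<Longrightarrow> H m \<le> H t"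
  proof (cases "m0 = a \<or> m0 = c")
    case True
    then have "H \<theta> \<le> H t" if "t \<in> {a..c}" for t
      using m0(2)[OF that] \<open>\<not> H \<theta> > 0\<close> assms(3,4) by auto
    then show ?thesis
      using that assms(5,6) by blast
  next
    case False
    then show ?thesis
      using that[of m0] m0 by (auto simp: less_le)
  qed
  have "m > 0"
    using m assms(1) by simp
  have "m * deriv (deriv p) m * E m = 0"
  proof (rule DERIV_local_min[OF DERIV_H[OF \<open>m > 0\<close>]])
    show "0 < min (m - a) (c - m)"
      using m by simp
    show "\<forall>t. \<bar>m - t\<bar> < min (m - a) (c - m) \<longrightarrow> H m \<le> H t"
      using m(3) by (auto simp: abs_if split: if_splits)
  qed
  then have "E m = 0"
    using \<open>m > 0\<close> p''_pos[of m] by simp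
  \<comment> \<open>\<open>E\<close> is negative just to the right of \<open>m\<close>, so
    \<open>H\<close> drops below its minimum there.\<close>
  obtain d where d: "d > 0" "\<And>h. 0 < h \<Longrightarrow> h < d \<Longrightarrow> E (m + h) < E m"
    using DERIV_neg_dec_right[OF DERIV_E[OF \<open>m > 0\<close>] E_decreasing_at_zero[OF \<open>m > 0\<close> \<open>E m = 0\<close>]]
    by blast
  define h where "h = min (d / 2) ((c - m) / 2)"
  have h: "0 < h" "h < d" "m + h < c"
    using d(1) m(2) by (auto simp: h_def min_def field_simps)
  have "H (m + h) < H m"
  proof (rule DERIV_neg_imp_decreasing_open[where f = H])
    show "m < m + h"
      using h by simp
    fix t assume t: "m < t" "t < m + h"
    then have "t > 0" "E t < 0"
      using \<open>m > 0\<close> d(2)[of "t - m"] h \<open>E m = 0\<close> by auto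
    then have "t * deriv (deriv p) t * E t < 0"
      using p''_pos[of t] by (simp add: mult_pos_neg)
    with DERIV_H[OF \<open>t > 0\<close>]
    show "\<exists>y. (H has_real_derivative y) (at t) \<and> y < 0"
      by blast
  next
    show "continuous_on {m..m + h} H"
      using DERIV_H \<open>m > 0\<close> by (meson DERIV_isCont continuous_at_imp_continuous_on atLeastAtMost_iff less_le_trans)
  qed
  then show False
    using m(3)[of "m + h"] h m(1) by simp
qed

lemma E_nonpos_at_right_zero:
  assumes "0 < a" "a < c" "H a = 0" "H c = 0"
  shows "E c \<le> 0"
proof (rule ccontr)
  assume "\<not> E c \<le> 0"
  then have "c * deriv (deriv p) c * E c > 0"
    using assms p''_pos[of c] by simp
  then obtain d where d: "d > 0" "\<And>h. 0 < h \<Longrightarrow> h < d \<Longrightarrow> H (c - h) < H c"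
    using DERIV_pos_inc_left[OF DERIV_H[of c]] assms by auto
  define h where "h = min (d / 2) ((c - a) / 2)"
  have "0 < h" "h < d" "a < c - h" "c - h < c"
    using d(1) assms(2) by (auto simp: h_def min_def field_simps)
  then show False
    using d(2)[of h] H_pos_between[OF assms, of "c - h"] assms(4) by simp
qed

lemma mprod_profile_velocity:
  assumes "\<theta> \<in> dom"
  shows "mprod (profile_velocity \<theta>) (profile_velocity \<theta>) = - 1"
    and "mprod X (profile_velocity \<theta>) = q0 / sqrt (K \<theta>)"
    and "profile_velocity \<theta> $ 0 > 0"
proof -
  have s: "sqrt (K \<theta>) > 0" "sqrt (K \<theta>) * sqrt (K \<theta>) = b \<theta> ^ 2 - q0 ^ 2"
    using K_pos[OF assms] by (simp_all add: K_def)
  show 1: "mprod (profile_velocity \<theta>) (profile_velocity \<theta>) = - 1"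
    using s by (simp add: profile_velocity_def mprod_linear NN XX XN NX power2_eq_square field_simps)
  show "mprod X (profile_velocity \<theta>) = q0 / sqrt (K \<theta>)"
    by (simp add: profile_velocity_def mprod_linear XX XN divide_inverse)
  have "mprod N (profile_velocity \<theta>) = - b \<theta> / sqrt (K \<theta>)"
    by (simp add: profile_velocity_def mprod_linear NN NX divide_inverse)
  then have "mprod N (profile_velocity \<theta>) < 0"
    using s dom_b[OF assms] by simp
  then show "profile_velocity \<theta> $ 0 > 0"
    using timelike_future[of N] NN N_future 1 by simp
qed

lemma profile_state:
  assumes "\<theta> \<in> dom"
  shows "profile_state \<theta> \<in> states" "temp (profile_state \<theta>) = \<theta>"
    "velocity (profile_state \<theta>) = profile_velocity \<theta>"
  unfolding profile_state_def
  using mprod_profile_velocity[OF assms] dom_pos[OF assms]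
  by (auto intro: scaled_velocity_in_states temp_scaled_velocity velocity_scaled_velocity)

text \<open>The deficit has no component along \<open>U\<close>, by the choice of
  \<open>profile_velocity\<close>, so only a multiple of \<open>q0 N + b X\<close> can remain. The
  computation rests on \<open>\<theta> p' = b - (q1 - p)\<close>, which yields
  \<open>\<theta> p' b = K - H\<close>.\<close>

lemma flux_profile_state:
  assumes "\<theta> \<in> dom"
  shows "normal_flux p \<xi> (profile_state \<theta>) \<alpha> =
    (q0 *\<^sub>R N + q1 *\<^sub>R X) $ \<alpha> - H \<theta> / K \<theta> * (q0 *\<^sub>R N + b \<theta> *\<^sub>R X) $ \<alpha>"
proof -
  let ?w = "\<theta> * deriv p \<theta>"
  have w: "?w = b \<theta> - q1 + p \<theta>"
    by (simp add: b_def energy_density_def)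
  have K: "K \<theta> > 0" "sqrt (K \<theta>) * sqrt (K \<theta>) = K \<theta>"
    using K_pos[OF assms] by auto
  have "normal_flux p \<xi> (profile_state \<theta>) \<alpha>
      = ?w * (q0 / sqrt (K \<theta>)) * profile_velocity \<theta> $ \<alpha> + p \<theta> * X $ \<alpha>"
    by (simp add: normal_flux_eq profile_state[OF assms] mprod_profile_velocity(2)[OF assms])
  also have "\<dots> = ?w * q0 / K \<theta> * (b \<theta> * N $ \<alpha> + q0 * X $ \<alpha>) + p \<theta> * X $ \<alpha>"
    using K by (simp add: profile_velocity_def field_simps)
  also have "\<dots> = (q0 * (?w * b \<theta>) * N $ \<alpha> + (?w * q0\<^sup>2 + p \<theta> * K \<theta>) * X $ \<alpha>) / K \<theta>"
    using K(1) by (simp add: field_simps power2_eq_square)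
  also have "?w * b \<theta> = K \<theta> - H \<theta>"
    unfolding w K_def H_def by (simp add: algebra_simps power2_eq_square)
  also have "?w * q0\<^sup>2 + p \<theta> * K \<theta> = q1 * K \<theta> - b \<theta> * H \<theta>"
    unfolding w K_def H_def by (simp add: algebra_simps power2_eq_square)
  also have "(q0 * (K \<theta> - H \<theta>) * N $ \<alpha> + (q1 * K \<theta> - b \<theta> * H \<theta>) * X $ \<alpha>) / K \<theta>
      = (q0 *\<^sub>R N + q1 *\<^sub>R X) $ \<alpha> - H \<theta> / K \<theta> * (q0 *\<^sub>R N + b \<theta> *\<^sub>R X) $ \<alpha>"
    using K(1) by (simp add: field_simps)
  finally show ?thesis .
qed

text \<open>A unit vector moving in the plane of \<open>N\<close> and \<open>X\<close> has its
  derivative along the orthogonal direction. The scalar factor comes from \<open>K' = 2 b b'\<close>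
  and \<open>K - b\<^sup>2 = - q0\<^sup>2\<close>.\<close>

lemma DERIV_profile_velocity:
  assumes "\<theta> \<in> dom"
  shows "((\<lambda>\<theta>. profile_velocity \<theta> $ \<gamma>) has_real_derivative
    - (\<theta> * deriv (deriv p) \<theta> * q0 / (K \<theta> * sqrt (K \<theta>))) * (q0 *\<^sub>R N + b \<theta> *\<^sub>R X) $ \<gamma>) (at \<theta>)"
proof -
  have K: "K \<theta> > 0"
    by (rule K_pos[OF assms])
  then obtain r where r: "r > 0" "sqrt (K \<theta>) = r" "K \<theta> = r\<^sup>2"
    by (metis real_sqrt_gt_zero real_sqrt_pow2 less_imp_le)
  have "((\<lambda>\<theta>. inverse (sqrt (K \<theta>))) has_real_derivative
      - (inverse r * (2 * b \<theta> * (\<theta> * deriv (deriv p) \<theta>) * (inverse r / 2)) * inverse r)) (at \<theta>)"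
    using DERIV_inverse'[OF DERIV_chain2[OF DERIV_real_sqrt[OF K] DERIV_K[OF dom_pos[OF assms]]]] r
    by (simp add: mult.commute)
  from DERIV_mult[OF this DERIV_add[OF DERIV_cmult_right[OF DERIV_b[OF dom_pos[OF assms]]] DERIV_const]]
  have D: "((\<lambda>\<theta>. inverse (sqrt (K \<theta>)) * (b \<theta> * N $ \<gamma> + q0 * X $ \<gamma>)) has_real_derivative
      - (inverse r * (2 * b \<theta> * (\<theta> * deriv (deriv p) \<theta>) * (inverse r / 2)) * inverse r)
        * (b \<theta> * N $ \<gamma> + q0 * X $ \<gamma>) + (\<theta> * deriv (deriv p) \<theta> * N $ \<gamma> + 0) * inverse r) (at \<theta>)"
    using r by simp
  have "- (inverse r * (2 * b \<theta> * (\<theta> * deriv (deriv p) \<theta>) * (inverse r / 2)) * inverse r)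
        * (b \<theta> * N $ \<gamma> + q0 * X $ \<gamma>) + (\<theta> * deriv (deriv p) \<theta> * N $ \<gamma> + 0) * inverse r
      = \<theta> * deriv (deriv p) \<theta> / r ^ 3 * ((r\<^sup>2 - (b \<theta>)\<^sup>2) * N $ \<gamma> - b \<theta> * q0 * X $ \<gamma>)"
    using r(1) by (simp add: field_simps power2_eq_square power3_eq_cube)
  also have "r\<^sup>2 - (b \<theta>)\<^sup>2 = - q0\<^sup>2"
    using r(3) by (simp add: K_def)
  also have "\<theta> * deriv (deriv p) \<theta> / r ^ 3 * (- q0\<^sup>2 * N $ \<gamma> - b \<theta> * q0 * X $ \<gamma>)
      = - (\<theta> * deriv (deriv p) \<theta> * q0 / (K \<theta> * sqrt (K \<theta>))) * (q0 *\<^sub>R N + b \<theta> *\<^sub>R X) $ \<gamma>"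
    unfolding r(2) unfolding r(3)
    using r(1) by (simp add: field_simps power2_eq_square power3_eq_cube)
  finally show ?thesis
    using DERIV_cong[OF D] by (simp only: profile_velocity_def vector_scaleR_component
        vector_add_component real_scaleR_def)
qed

section \<open>Smoothness of the curve of profile states\<close>

lemma smooth_b: "smooth_on dom b"
proof -
  have "smooth_on {0<..} b"
    unfolding b_def[abs_def] energy_density_def
    by (intro smooth_on_add smooth_on_diff smooth_on_mult smooth_on_ident smooth_on_const
        smooth smooth_deriv open_greaterThan)
  then show ?thesis
    by (rule smooth_on_subset) (auto simp: dom_def)
qed

lemma smooth_on_dom: "smooth_on {0<..} f \<Longrightarrow> smooth_on dom f"
  by (erule smooth_on_subset) (auto simp: dom_def)

lemma smooth_K: "smooth_on dom K"
  unfolding K_def[abs_def] power2_eq_square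
  by (intro smooth_on_diff smooth_on_mult smooth_on_const smooth_b open_dom)

lemma smooth_H: "smooth_on dom H"
  unfolding H_def[abs_def]
  by (intro smooth_on_diff smooth_on_mult smooth_on_const smooth_b smooth_on_dom[OF smooth] open_dom)

lemma smooth_profile_state: "smooth_on dom profile_state"
  unfolding profile_state_def[abs_def] profile_velocity_def divide_inverse mult_1_left
  by (intro smooth_on_scaleR smooth_on_add smooth_on_const smooth_b smooth_on_inverse
      smooth_on_sqrt smooth_K smooth_on_ident open_dom)
    (use K_pos dom_pos in auto)

text \<open>Comparing the components of \<open>w v U + p X = q0 N + q1 X\<close> along
  \<open>X\<close> and orthogonal to it gives \<open>q1 = w v\<^sup>2 + p\<close> and
  \<open>q0 = w v r\<close>, hence \<open>b = w r\<^sup>2\<close> and \<open>sqrt K = w r\<close>.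
  The claims are read off from these values.\<close>

lemma state_on_profile:
  assumes "\<psi> \<in> states" and flux: "\<And>\<alpha>. normal_flux p \<xi> \<psi> \<alpha> = (q0 *\<^sub>R N + q1 *\<^sub>R X) $ \<alpha>"
  shows "temp \<psi> \<in> dom" "H (temp \<psi>) = 0" "profile_state (temp \<psi>) = \<psi>"
    "mprod X (velocity \<psi>) * q0 > 0"
    "E (temp \<psi>) = temp \<psi> * deriv p (temp \<psi>) *
      ((mprod X (velocity \<psi>))\<^sup>2 - csq (temp \<psi>) * (1 + (mprod X (velocity \<psi>))\<^sup>2))"
proof -
  define U v \<theta> where "U = velocity \<psi>" and "v = mprod X (velocity \<psi>)" and "\<theta> = temp \<psi>"
  define w where "w = \<theta> * deriv p \<theta>"
  define Y where "Y = U - v *\<^sub>R X"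
  define r where "r = sqrt (1 + v\<^sup>2)"
  have r: "r > 0" "r\<^sup>2 = 1 + v\<^sup>2"
    by (auto simp: r_def add_pos_nonneg)
  have "\<theta> > 0"
    using temp_pos[OF assms(1)] by (simp add: \<theta>_def)
  then have w: "w > 0"
    using p'_pos by (simp add: w_def)
  have UU: "mprod U U = - 1" "U $ 0 > 0"
    using assms(1) by (simp_all add: U_def mprod_velocity velocity_future)
  have XU: "mprod X U = v" "mprod U X = v"
    by (simp_all add: U_def v_def mprod_commute)
  have eq: "(w * v) *\<^sub>R U + p \<theta> *\<^sub>R X = q0 *\<^sub>R N + q1 *\<^sub>R X"
    using flux by (simp add: vec_eq_iff normal_flux_eq w_def U_def v_def \<theta>_def)
  from arg_cong[OF eq, of "mprod X"] have q1: "q1 = w * v\<^sup>2 + p \<theta>"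
    by (simp add: mprod_linear XU XX XN power2_eq_square)
  have wY: "(w * v) *\<^sub>R Y = q0 *\<^sub>R N"
    using eq unfolding q1 Y_def by (simp add: algebra_simps power2_eq_square)
  have YY: "mprod Y Y = - r\<^sup>2" "mprod U Y = - r\<^sup>2"
    unfolding r by (simp_all add: Y_def mprod_linear UU XU XX power2_eq_square algebra_simps)
  then have Y0: "Y $ 0 > 0"
    using timelike_future[of U Y] UU r(1) by simp
  have "mprod ((w * v) *\<^sub>R Y) ((w * v) *\<^sub>R Y) = mprod (q0 *\<^sub>R N) (q0 *\<^sub>R N)"
    by (simp only: wY)
  then have q0sq: "q0\<^sup>2 = (w * v * r)\<^sup>2"
    by (simp add: mprod_linear YY NN power2_eq_square algebra_simps)
  then have v0: "v \<noteq> 0"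
    using q0 by auto
  \<comment> \<open>\<open>Y\<close> and \<open>N\<close> are both future-directed, so
    \<open>v\<close> and \<open>q0\<close> have the same sign; this selects the root of
    \<open>q0\<^sup>2 = (w v r)\<^sup>2\<close>.\<close>
  have "v * q0 * N $ 0 = w * v\<^sup>2 * Y $ 0"
    using arg_cong[OF wY[symmetric], of "\<lambda>x. v * x $ 0"] by (simp add: power2_eq_square mult_ac)
  also have "\<dots> > 0"
    using w v0 Y0 by simp
  finally have vq: "v * q0 > 0"
    using N_future by (simp add: zero_less_mult_iff)
  then have q0_eq: "q0 = w * v * r"
  proof -
    have "w * r * v\<^sup>2 > 0"
      using w r(1) v0 by simp
    then have "v * (w * v * r) > 0"
      by (simp add: power2_eq_square mult_ac)
    moreover have "q0 = w * v * r \<or> q0 = - (w * v * r)"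
      using q0sq by (simp add: power2_eq_iff)
    ultimately show ?thesis
      using vq by auto
  qed
  have b: "b \<theta> = w * r\<^sup>2"
    unfolding b_def energy_density_def r by (simp add: q1 w_def algebra_simps)
  have "\<bar>v\<bar> < r"
    by (rule power2_less_imp_less) (simp_all add: r(2) less_imp_le[OF r(1)])
  then have "w * r * \<bar>v\<bar> < w * r * r"
    using w r(1) by simp
  then have "\<bar>q0\<bar> < b \<theta>"
    unfolding b unfolding q0_eq using w r(1) by (simp add: abs_mult power2_eq_square mult_ac)
  then show dom: "temp \<psi> \<in> dom"
    using \<open>\<theta> > 0\<close> by (simp add: dom_def \<theta>_def)
  have "K \<theta> = (w * r)\<^sup>2 * (r\<^sup>2 - v\<^sup>2)"
    unfolding K_def b unfolding q0_eq by (simp add: power2_eq_square algebra_simps)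
  then have K: "sqrt (K \<theta>) = w * r"
    using w r by simp
  show "H (temp \<psi>) = 0"
    unfolding \<theta>_def[symmetric] H_def b unfolding q1 q0_eq by (simp add: power2_eq_square)
  have "v *\<^sub>R Y = v *\<^sub>R (r *\<^sub>R N)"
    using wY w unfolding q0_eq by (simp add: vec_eq_iff mult_ac)
  then have "Y = r *\<^sub>R N"
    using v0 by (rule scaleR_left_imp_eq[rotated])
  then have "U = r *\<^sub>R N + v *\<^sub>R X"
    by (simp add: Y_def algebra_simps)
  moreover have "profile_velocity \<theta> = r *\<^sub>R N + v *\<^sub>R X"
    unfolding profile_velocity_def K b unfolding q0_eq using w r(1)
    by (simp add: vec_eq_iff field_simps power2_eq_square)
  ultimately show "profile_state (temp \<psi>) = \<psi>"
    using state_eq_velocity[OF assms(1)] by (simp add: profile_state_def \<theta>_def U_def)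
  show "mprod X (velocity \<psi>) * q0 > 0"
    using vq by (simp add: v_def)
  show "E (temp \<psi>) = temp \<psi> * deriv p (temp \<psi>) *
      ((mprod X (velocity \<psi>))\<^sup>2 - csq (temp \<psi>) * (1 + (mprod X (velocity \<psi>))\<^sup>2))"
    unfolding \<theta>_def[symmetric] v_def[symmetric] w_def[symmetric] E_def b
    unfolding r q1 by (simp add: algebra_simps)
qed

end

text \<open>The ends are ordered by temperature, \<open>a\<close> being the colder one. As
  \<open>H\<close> is positive in between, the sign of \<open>q0\<close> decides whether the
  temperature rises or falls with \<open>s\<close>.\<close>

lemma (in shock_flux) profile_exists:
  assumes "smooth_on states \<eta>" "\<And>\<psi>. \<psi> \<in> states \<Longrightarrow> \<eta> \<psi> > 0"
    and "smooth_on states \<zeta>" "\<And>\<psi>. \<psi> \<in> states \<Longrightarrow> \<zeta> \<psi> > 0"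
    and a: "a \<in> dom" "a < c" "H a = 0" "H c = 0"
  shows "\<exists>\<Psi>. dissipation_profile p \<eta> \<zeta> (\<lambda>\<psi>. 0) (profile_state (if q0 > 0 then a else c))
    (profile_state (if q0 > 0 then c else a)) \<xi> \<Psi>"
proof -
  define \<sigma> where "\<sigma> \<theta> = (4/3 * \<eta> (profile_state \<theta>) + \<zeta> (profile_state \<theta>)) * inverse (1 - csq \<theta>)" for \<theta>
  \<comment> \<open>The value of \<open>\<theta>'\<close> for which
    \<open>\<sigma> U' = - (H / K) (q0 N + b X)\<close>: insert
    \<open>DERIV_profile_velocity\<close> and compare the factors of
    \<open>q0 N + b X\<close>.\<close>
  define G where "G \<theta> = sqrt (K \<theta>) * H \<theta> * inverse (\<sigma> \<theta> * (\<theta> * deriv (deriv p) \<theta>)) * (1 / q0)" for \<theta>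
  have in_dom: "\<theta> \<in> dom" if "a \<le> \<theta>" for \<theta>
    using dom_upward[OF a(1) that] .
  have visc_pos: "4/3 * \<eta> (profile_state \<theta>) + \<zeta> (profile_state \<theta>) > 0"
    and csq1: "1 - csq \<theta> > 0" if "\<theta> \<in> dom" for \<theta>
    using assms(2,4)[OF profile_state(1)[OF that]] csq_less_1[OF dom_pos[OF that]] by auto
  then have \<sigma>_pos: "\<sigma> \<theta> > 0" if "\<theta> \<in> dom" for \<theta>
    using that by (simp add: \<sigma>_def)
  have visc_smooth: "smooth_on dom (\<lambda>\<theta>. f (profile_state \<theta>))" if "smooth_on states f" for f :: "real^4 \<Rightarrow> real"
    using smooth_on_compose[OF open_dom smooth_profile_state that] profile_state(1) by auto
  have "smooth_on dom \<sigma>"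
    unfolding \<sigma>_def[abs_def]
    by (intro smooth_on_mult smooth_on_add smooth_on_const smooth_on_inverse smooth_on_diff
        visc_smooth assms(1,3) smooth_on_dom[OF smooth_csq] open_dom csq1)
  then have G_smooth: "smooth_on dom G"
    unfolding G_def[abs_def]
    by (intro smooth_on_mult smooth_on_const smooth_on_inverse smooth_on_sqrt smooth_H smooth_K
        smooth_on_ident smooth_on_dom[OF smooth_deriv2] open_dom K_pos mult_pos_pos \<sigma>_pos
        dom_pos p''_pos)
  have G_diff: "G differentiable (at \<theta>)" if "a \<le> \<theta>" for \<theta>
    using smooth_on_imp_differentiable[OF G_smooth in_dom[OF that]] .
  have G_zero: "G a = 0" "G c = 0"
    using a by (simp_all add: G_def)
  have qG_pos: "q0 * G \<theta> > 0" if "a < \<theta>" "\<theta> < c" for \<theta>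
  proof -
    have d: "\<theta> \<in> dom"
      using in_dom that by simp
    have "H \<theta> > 0"
      using H_pos_between[OF dom_pos[OF a(1)] a(2-4) that] .
    then have "sqrt (K \<theta>) * H \<theta> * inverse (\<sigma> \<theta> * (\<theta> * deriv (deriv p) \<theta>)) > 0"
      using K_pos[OF d] \<sigma>_pos[OF d] dom_pos[OF d] p''_pos
      by (intro mult_pos_pos positive_imp_inverse_positive) auto
    then show ?thesis
      using q0 by (simp add: G_def)
  qed
  obtain \<theta> where \<theta>: "\<And>s. (\<theta> has_real_derivative G (\<theta> s)) (at s)" "range \<theta> \<subseteq> {a<..<c}"
    "(\<theta> \<longlongrightarrow> (if q0 > 0 then a else c)) at_bot" "(\<theta> \<longlongrightarrow> (if q0 > 0 then c else a)) at_top"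
  proof (cases "q0 > 0")
    case True
    then have "G x > 0" if "a < x" "x < c" for x
      using qG_pos[OF that] by (simp add: zero_less_mult_iff)
    then show ?thesis
      using heteroclinic_orbit[OF a(2) _ G_zero G_diff] that True by auto
  next
    case False
    \<comment> \<open>For negative \<open>q0\<close> an orbit of \<open>- G\<close> is run backwards
      in \<open>s\<close>.\<close>
    then have "- G x > 0" if "a < x" "x < c" for x
      using qG_pos[OF that] q0 by (simp add: zero_less_mult_iff)
    then obtain \<phi> where \<phi>: "\<And>s. (\<phi> has_real_derivative - G (\<phi> s)) (at s)" "range \<phi> \<subseteq> {a<..<c}"
      "(\<phi> \<longlongrightarrow> a) at_bot" "(\<phi> \<longlongrightarrow> c) at_top"
      using heteroclinic_orbit[of a c "\<lambda>x. - G x"] a(2) G_zero G_diff by auto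
    have "((\<lambda>s. \<phi> (- s)) has_real_derivative G (\<phi> (- s))) (at s)" for s
      using DERIV_chain2[OF \<phi>(1) DERIV_minus[OF DERIV_ident], of s] by simp
    moreover have "range (\<lambda>s. \<phi> (- s)) \<subseteq> {a<..<c}"
      using \<phi>(2) by blast
    moreover have "((\<lambda>s. \<phi> (- s)) \<longlongrightarrow> c) at_bot"
      by (rule filterlim_compose[OF \<phi>(4) filterlim_uminus_at_top_at_bot])
    moreover have "((\<lambda>s. \<phi> (- s)) \<longlongrightarrow> a) at_top"
      by (rule filterlim_compose[OF \<phi>(3) filterlim_uminus_at_bot_at_top])
    ultimately show ?thesis
      using that[of "\<lambda>s. \<phi> (- s)"] False by auto
  qed
  have \<theta>_dom: "\<theta> s \<in> dom" for s
    using \<theta>(2) by (intro in_dom) (auto simp: image_subset_iff less_imp_le)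
  then have \<theta>_dom': "range \<theta> \<subseteq> dom"
    by blast
  define \<Psi> where "\<Psi> s = profile_state (\<theta> s)" for s
  have \<Psi>_smooth: "smooth_on UNIV \<Psi>"
    unfolding \<Psi>_def[abs_def]
    by (rule smooth_on_compose[OF _ smooth_on_ode_solution[OF \<theta>(1) G_smooth \<theta>_dom']
          smooth_profile_state \<theta>_dom']) simp
  have \<Psi>_states: "range \<Psi> \<subseteq> states"
    using profile_state(1)[OF \<theta>_dom] by (auto simp: \<Psi>_def)
  have lim: "(\<Psi> \<longlongrightarrow> profile_state x) F" if "(\<theta> \<longlongrightarrow> x) F" "x \<in> {a, c}" for x F
  proof -
    have "x \<in> dom"
      using that(2) in_dom a(2) by auto
    then have "isCont profile_state x"
      using smooth_on_imp_differentiable[OF smooth_profile_state]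
      by (simp add: differentiable_imp_continuous_within)
    then show ?thesis
      unfolding \<Psi>_def[abs_def] using that(1) by (rule isCont_tendsto_compose)
  qed
  have eq: "- (\<Sum>\<beta>\<in>UNIV. \<xi> $ \<beta> * dissipation_along p \<eta> \<zeta> (\<lambda>\<psi>. 0) \<xi> \<Psi> s \<alpha> \<beta>) =
      normal_flux p \<xi> (\<Psi> s) \<alpha> - (q0 *\<^sub>R N + q1 *\<^sub>R X) $ \<alpha>" for s \<alpha>
  proof -
    let ?t = "\<theta> s" and ?V = "profile_velocity (\<theta> s)"
    note d = \<theta>_dom[of s]
    define B where "B = b ?t"
    define k where "k = K ?t"
    \<comment> \<open>The factor for which \<open>\<sigma>\<close> times \<open>m Z\<close> is the
      flux deficit \<open>- (H / K) Z\<close>; the chain rule below confirms that \<open>m Z\<close>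
      is the derivative of the velocity.\<close>
    define m where "m = - H ?t / (\<sigma> ?t * k)"
    define Z where "Z = q0 *\<^sub>R N + B *\<^sub>R X"
    define D where "D = m *\<^sub>R Z"
    have k: "k > 0" "sqrt k * sqrt k = k" "k = B\<^sup>2 - q0\<^sup>2"
      using K_pos[OF d] by (auto simp: k_def K_def B_def)
    have V: "?V = inverse (sqrt k) *\<^sub>R (B *\<^sub>R N + q0 *\<^sub>R X)"
      by (simp add: profile_velocity_def B_def k_def)
    have "((\<lambda>t. profile_velocity (\<theta> t) $ \<gamma>) has_real_derivative D $ \<gamma>) (at s)" for \<gamma>
    proof -
      define e where "e = - (?t * deriv (deriv p) ?t * q0 / (k * sqrt k))"
      have "e * G ?t = m"
        unfolding e_def G_def k_def[symmetric] m_def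
        using k(1) q0 \<sigma>_pos[OF d] dom_pos[OF d] p''_pos[of ?t] by (simp add: field_simps)
      then have "e * Z $ \<gamma> * G ?t = D $ \<gamma>"
        unfolding D_def vector_scaleR_component real_scaleR_def by (metis mult.assoc mult.commute)
      then show ?thesis
        using DERIV_chain2[OF DERIV_profile_velocity[OF d] \<theta>(1), of \<gamma>]
        by (simp only: e_def k_def B_def Z_def)
    qed
    then have D: "deriv (\<lambda>t. velocity (\<Psi> t) $ \<gamma>) s = D $ \<gamma>" for \<gamma>
      unfolding \<Psi>_def profile_state(3)[OF \<theta>_dom] by (rule DERIV_imp_deriv)
    note ps = profile_state[OF d, folded \<Psi>_def]
    have css: "sound_speed_sq p (temp (\<Psi> s)) = csq ?t"
      using sound_speed_sq[OF dom_pos[OF d]] by (simp add: ps)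
    have main: "- (\<Sum>\<beta>\<in>UNIV. \<xi> $ \<beta> * dissipation_along p \<eta> \<zeta> (\<lambda>\<psi>. 0) \<xi> \<Psi> s \<alpha> \<beta>) =
        (4/3 * \<eta> (\<Psi> s) + \<zeta> (\<Psi> s)) / (1 - sound_speed_sq p (temp (\<Psi> s))) * D $ \<alpha>"
      unfolding dissipation_along_def D
    proof (rule dissipation_in_plane[OF ps(1) _ refl refl])
      show "sound_speed_sq p (temp (\<Psi> s)) \<noteq> 1"
        using csq1[OF d] by (simp add: css)
      show "mprod (velocity (\<Psi> s)) D = 0"
        unfolding ps V D_def Z_def by (simp add: mprod_linear NN NX XN XX)
      have v: "mprod X (velocity (\<Psi> s)) = q0 * inverse (sqrt k)"
        unfolding ps V by (simp add: mprod_linear XX XN)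
      have dd: "mprod X D = m * B"
        by (simp add: D_def Z_def mprod_linear XX XN)
      have v2: "(q0 * inverse (sqrt k))\<^sup>2 = q0\<^sup>2 / k"
        using k by (simp add: power_mult_distrib power_inverse divide_inverse)
      have 1: "1 + q0\<^sup>2 / k = B\<^sup>2 / k"
        using k(1) by (simp add: k(3) field_simps)
      have "(q0 * inverse (sqrt k)) *\<^sub>R ?V = (q0 / k) *\<^sub>R (B *\<^sub>R N + q0 *\<^sub>R X)"
        unfolding V using k by (simp add: field_simps)
      then have "X + (q0 * inverse (sqrt k)) *\<^sub>R ?V = (1 + q0\<^sup>2 / k) *\<^sub>R X + (q0 * B / k) *\<^sub>R N"
        by (simp add: algebra_simps power2_eq_square)
      also have "\<dots> = (B / k) *\<^sub>R Z"
        unfolding 1 Z_def by (simp add: algebra_simps power2_eq_square)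
      finally have Y: "X + (q0 * inverse (sqrt k)) *\<^sub>R ?V = (B / k) *\<^sub>R Z" .
      show "(1 + (mprod X (velocity (\<Psi> s)))\<^sup>2) *\<^sub>R D =
          mprod X D *\<^sub>R (X + mprod X (velocity (\<Psi> s)) *\<^sub>R velocity (\<Psi> s))"
        unfolding v dd v2 1 unfolding ps(3) Y by (simp add: D_def power2_eq_square)
    qed (rule \<xi>\<xi>)
    have "(4/3 * \<eta> (\<Psi> s) + \<zeta> (\<Psi> s)) / (1 - sound_speed_sq p (temp (\<Psi> s))) = \<sigma> ?t"
      unfolding css unfolding \<sigma>_def \<Psi>_def divide_inverse ..
    note main[unfolded this]
    also have "\<sigma> ?t * D $ \<alpha> = - (H ?t / k) * Z $ \<alpha>"
      using \<sigma>_pos[OF d] k(1) by (simp add: D_def m_def)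
    also have "\<dots> = normal_flux p \<xi> (\<Psi> s) \<alpha> - (q0 *\<^sub>R N + q1 *\<^sub>R X) $ \<alpha>"
      unfolding \<Psi>_def flux_profile_state[OF d] by (simp add: Z_def B_def k_def)
    finally show ?thesis .
  qed
  have "normal_flux p \<xi> (profile_state (if q0 > 0 then a else c)) \<alpha> = (q0 *\<^sub>R N + q1 *\<^sub>R X) $ \<alpha>" for \<alpha>
    using flux_profile_state[of a \<alpha>] flux_profile_state[of c \<alpha>] in_dom[of a] in_dom[of c] a by simp
  then have "dissipation_profile p \<eta> \<zeta> (\<lambda>\<psi>. 0) (profile_state (if q0 > 0 then a else c))
    (profile_state (if q0 > 0 then c else a)) \<xi> \<Psi>"
    unfolding dissipation_profile_def
    using \<Psi>_smooth \<Psi>_states eq lim[OF \<theta>(3)] lim[OF \<theta>(4)] by auto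
  then show ?thesis
    by blast
qed

section \<open>Lax shocks\<close>

lemma poly_det: "poly (det A) x = det (\<chi> i j. poly (A $ i $ j) x)"
  for A :: "'a::comm_ring_1 poly^'n^'n"
  by (simp add: det_def poly_sum poly_prod)

lemma det_eq_0_if_kernel:
  fixes A :: "real^'n^'n"
  assumes "A *v x = 0" "x \<noteq> 0"
  shows "det A = 0"
  using assms by (metis invertible_det_nz invertible_left_inverse matrix_left_invertible_ker)

context causal_fluid
begin

text \<open>The columns of the matrix belong to derivatives by covariant components, so the kernel
  vector \<open>x\<close> carries lower indices.\<close>

lemma char_polynomial_root:
  assumes "\<phi> \<in> states" "x \<noteq> 0"
    and "\<And>\<alpha>. (\<Sum>\<gamma>\<in>UNIV. (third_moment \<phi> \<alpha> 1 \<gamma> - \<mu> * third_moment \<phi> \<alpha> 0 \<gamma>) * x $ \<gamma>) = 0"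
  shows "poly (char_polynomial p \<phi>) \<mu> = 0"
  unfolding char_polynomial_def poly_det
  by (rule det_eq_0_if_kernel[OF _ assms(2)])
    (simp add: vec_eq_iff matrix_vector_mult_def pd_lower_energy_momentum[OF assms(1)] assms(3))

text \<open>The kernel vector is orthogonal to \<open>\<phi>\<close> and to the time and normal directions.\<close>

lemma char_polynomial_contact_root:
  assumes "\<phi> \<in> states"
  shows "poly (char_polynomial p \<phi>) (\<phi> $ 1 / \<phi> $ 0) = 0"
proof -
  have "\<phi> $ 0 > 0"
    using assms by (simp add: states_def)
  then have s: "\<phi> $ 1 = \<phi> $ 1 / \<phi> $ 0 * \<phi> $ 0"
    by simp
  define \<mu> where "\<mu> = \<phi> $ 1 / \<phi> $ 0"
  \<comment> \<open>A direction in the transverse plane orthogonal to the transverse part of the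
    flow; any direction serves if that part is zero.\<close>
  obtain y z where yz: "\<phi> $ 2 * y + \<phi> $ 3 * z = 0" "y \<noteq> 0 \<or> z \<noteq> 0"
  proof (cases "\<phi> $ 2 = 0 \<and> \<phi> $ 3 = 0")
    case True
    then show ?thesis
      using that[of 1 0] by simp
  next
    case False
    then show ?thesis
      using that[of "\<phi> $ 3" "- \<phi> $ 2"] by auto
  qed
  define x :: "real^4" where "x = axis 2 y + axis 3 z"
  have x: "x $ 0 = 0" "x $ 1 = 0" "x $ 2 = y" "x $ 3 = z"
    by (simp_all add: x_def axis_def)
  have "poly (char_polynomial p \<phi>) \<mu> = 0"
  proof (rule char_polynomial_root[OF assms, where x = x])
    show "x \<noteq> 0"
      using yz(2) x by (metis zero_index)
    fix \<alpha>
    define a where "a = temp \<phi> ^ 3 * deriv p (temp \<phi>)"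
    define c where "c = temp \<phi> ^ 5 * (3 * deriv p (temp \<phi>) + temp \<phi> * deriv (deriv p) (temp \<phi>))"
    have "(\<Sum>\<gamma>\<in>UNIV. (third_moment \<phi> \<alpha> 1 \<gamma> - \<mu> * third_moment \<phi> \<alpha> 0 \<gamma>) * x $ \<gamma>)
      = (c * \<phi> $ \<alpha> * (\<phi> $ 1 - \<mu> * \<phi> $ 0) + a * (mink $ \<alpha> $ 1 - \<mu> * mink $ \<alpha> $ 0))
          * (\<phi> $ 2 * y + \<phi> $ 3 * z)
        + a * (\<phi> $ 1 - \<mu> * \<phi> $ 0) * (mink $ \<alpha> $ 2 * y + mink $ \<alpha> $ 3 * z)"
      unfolding third_moment_def a_def[symmetric] c_def[symmetric] sum_UNIV_4 x
      by (simp add: mink_component algebra_simps)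
    also have "\<phi> $ 1 - \<mu> * \<phi> $ 0 = 0"
      using s by (simp add: \<mu>_def)
    finally show "(\<Sum>\<gamma>\<in>UNIV. (third_moment \<phi> \<alpha> 1 \<gamma> - \<mu> * third_moment \<phi> \<alpha> 0 \<gamma>) * x $ \<gamma>) = 0"
      by (simp add: yz(1))
  qed
  then show ?thesis
    by (simp add: \<mu>_def)
qed

text \<open>The kernel vector is sought in the span of \<open>\<phi>\<close> and \<open>(\<mu>, 1, 0, 0)\<close>, indices lowered.\<close>

lemma char_polynomial_acoustic_root:
  assumes "\<phi> \<in> states"
    and root: "(1 - 1 / csq (temp \<phi>)) * (\<phi> $ 1 - \<mu> * \<phi> $ 0)\<^sup>2 + (1 - \<mu>\<^sup>2) / (temp \<phi>)\<^sup>2 = 0"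
  shows "poly (char_polynomial p \<phi>) \<mu> = 0"
proof -
  define \<theta> where "\<theta> = temp \<phi>"
  have \<theta>: "\<theta> > 0"
    using temp_pos[OF assms(1)] by (simp add: \<theta>_def)
  define a where "a = \<theta> ^ 3 * deriv p \<theta>"
  define k where "k = 1 / csq \<theta>"
  define n where "n = 1 / \<theta>\<^sup>2"
  define s where "s = \<phi> $ 1 - \<mu> * \<phi> $ 0"
  define \<tau> :: "real^4" where "\<tau> = axis 0 \<mu> + axis 1 1"
  \<comment> \<open>For the combination \<open>A \<phi> + B \<tau>\<close> the image has a component
    along \<open>\<tau>\<close> proportional to \<open>2 s B - n A\<close>. The choice
    \<open>A = 2 s\<close>, \<open>B = n\<close> removes it, and the component along
    \<open>\<phi>\<close> becomes the acoustic quadratic.\<close>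
  define x where "x = mink *v ((2 * s) *\<^sub>R \<phi> + n *\<^sub>R \<tau>)"
  have n: "n > 0" "mprod \<phi> \<phi> = - n"
    using \<theta> mprod_self_eq_temp[OF assms(1)] by (simp_all add: n_def \<theta>_def)
  have \<tau>: "\<tau> $ 0 = \<mu>" "\<tau> $ 1 = 1" "\<tau> $ 2 = 0" "\<tau> $ 3 = 0"
    by (simp_all add: \<tau>_def axis_def)
  have prods: "mprod \<phi> \<tau> = s" "mprod \<tau> \<phi> = s" "mprod \<tau> \<tau> = 1 - \<mu>\<^sup>2"
    by (simp_all add: mprod_expand \<tau> s_def power2_eq_square)
  have c: "\<theta> ^ 5 * (3 * deriv p \<theta> + \<theta> * deriv (deriv p) \<theta>) * n = a * (3 + k)"
    using \<theta> p'_pos[OF \<theta>] p''_pos[OF \<theta>]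
    by (simp add: a_def k_def csq_def n_def field_simps power_numeral_reduce)
  have root': "(1 - k) * s\<^sup>2 + n * (1 - \<mu>\<^sup>2) = 0"
    using root by (simp add: k_def n_def s_def \<theta>_def)
  show ?thesis
  proof (rule char_polynomial_root[OF assms(1), where x = x])
    show "x \<noteq> 0"
    proof
      assume "x = 0"
      then have z: "(2 * s) *\<^sub>R \<phi> + n *\<^sub>R \<tau> = 0"
        by (metis mink_mult_mink_mult matrix_vector_mult_0_right x_def)
      then have "mprod ((2 * s) *\<^sub>R \<phi> + n *\<^sub>R \<tau>) \<phi> = 0"
        by (simp add: mprod_expand)
      then have "s = 0"
        using n by (simp add: mprod_linear prods)
      then show False
        using arg_cong[OF z, of "\<lambda>x. x $ 1"] n by (simp add: \<tau>)
    qed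
    fix \<alpha>
    let ?c = "\<theta> ^ 5 * (3 * deriv p \<theta> + \<theta> * deriv (deriv p) \<theta>)"
    have \<phi>x: "(\<Sum>\<gamma>\<in>UNIV. \<phi> $ \<gamma> * x $ \<gamma>) = - s * n"
      and \<tau>x: "(\<Sum>\<gamma>\<in>UNIV. \<tau> $ \<gamma> * x $ \<gamma>) = 2 * s\<^sup>2 + n * (1 - \<mu>\<^sup>2)"
    proof -
      have "(\<Sum>\<gamma>\<in>UNIV. y $ \<gamma> * x $ \<gamma>) = mprod y ((2 * s) *\<^sub>R \<phi> + n *\<^sub>R \<tau>)" for y
        by (simp add: x_def sum_UNIV_4 mink_mult_component mprod_expand algebra_simps)
      then show "(\<Sum>\<gamma>\<in>UNIV. \<phi> $ \<gamma> * x $ \<gamma>) = - s * n"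
        "(\<Sum>\<gamma>\<in>UNIV. \<tau> $ \<gamma> * x $ \<gamma>) = 2 * s\<^sup>2 + n * (1 - \<mu>\<^sup>2)"
        by (simp_all add: mprod_linear prods n power2_eq_square algebra_simps)
    qed
    have x\<alpha>: "(\<Sum>\<gamma>\<in>UNIV. mink $ \<alpha> $ \<gamma> * x $ \<gamma>) = 2 * s * \<phi> $ \<alpha> + n * \<tau> $ \<alpha>"
      using index_cases[of \<alpha>] by (auto simp: x_def sum_UNIV_4 mink_component mink_mult_component)
    have m\<tau>: "mink $ \<alpha> $ 1 - \<mu> * mink $ \<alpha> $ 0 = \<tau> $ \<alpha>" "x $ 1 - \<mu> * (- x $ 0) = (\<Sum>\<gamma>\<in>UNIV. \<tau> $ \<gamma> * x $ \<gamma>)"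
      using index_cases[of \<alpha>] by (auto simp: mink_component \<tau> sum_UNIV_4)
    have "(\<Sum>\<gamma>\<in>UNIV. (third_moment \<phi> \<alpha> 1 \<gamma> - \<mu> * third_moment \<phi> \<alpha> 0 \<gamma>) * x $ \<gamma>)
      = ?c * \<phi> $ \<alpha> * (\<phi> $ 1 - \<mu> * \<phi> $ 0) * (\<Sum>\<gamma>\<in>UNIV. \<phi> $ \<gamma> * x $ \<gamma>)
        + a * ((\<phi> $ 1 - \<mu> * \<phi> $ 0) * (\<Sum>\<gamma>\<in>UNIV. mink $ \<alpha> $ \<gamma> * x $ \<gamma>)
          + \<phi> $ \<alpha> * (x $ 1 - \<mu> * (- x $ 0))
          + (mink $ \<alpha> $ 1 - \<mu> * mink $ \<alpha> $ 0) * (\<Sum>\<gamma>\<in>UNIV. \<phi> $ \<gamma> * x $ \<gamma>))"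
      unfolding third_moment_def a_def \<theta>_def sum_UNIV_4
      by (simp add: mink_component[of 0] mink_component[of 1] algebra_simps)
    also have "\<dots> = - (?c * n) * \<phi> $ \<alpha> * s\<^sup>2 + a * \<phi> $ \<alpha> * (4 * s\<^sup>2 + n * (1 - \<mu>\<^sup>2))"
      unfolding x\<alpha> \<phi>x m\<tau> \<tau>x s_def[symmetric] by (simp add: algebra_simps power2_eq_square)
    also have "\<dots> = a * \<phi> $ \<alpha> * ((1 - k) * s\<^sup>2 + n * (1 - \<mu>\<^sup>2))"
      unfolding c by (simp add: algebra_simps)
    finally show "(\<Sum>\<gamma>\<in>UNIV. (third_moment \<phi> \<alpha> 1 \<gamma> - \<mu> * third_moment \<phi> \<alpha> 0 \<gamma>) * x $ \<gamma>) = 0"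
      by (simp add: root')
  qed
qed

text \<open>The acoustic quadratic is nonpositive at \<open>-1\<close> and \<open>1\<close>; unless the flow is supersonic, it is
  nonnegative at \<open>0\<close>.\<close>

lemma not_supersonic_acoustic_roots:
  assumes "\<phi> \<in> states"
    and "(temp \<phi> * \<phi> $ 1)\<^sup>2 \<le> csq (temp \<phi>) * (1 + (temp \<phi> * \<phi> $ 1)\<^sup>2)"
  shows "\<exists>\<mu>\<le>0. poly (char_polynomial p \<phi>) \<mu> = 0" "\<exists>\<mu>\<ge>0. poly (char_polynomial p \<phi>) \<mu> = 0"
proof -
  define \<theta> where "\<theta> = temp \<phi>"
  have \<theta>: "\<theta> > 0"
    using temp_pos[OF assms(1)] by (simp add: \<theta>_def)
  define Q where "Q \<mu> = (1 - 1 / csq \<theta>) * (\<phi> $ 1 - \<mu> * \<phi> $ 0)\<^sup>2 + (1 - \<mu>\<^sup>2) / \<theta>\<^sup>2" for \<mu>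
  note c = csq_pos[OF \<theta>] csq_less_1[OF \<theta>]
  have Q1: "Q \<mu> \<le> 0" if "\<mu>\<^sup>2 = 1" for \<mu>
    using c that by (simp add: Q_def mult_le_0_iff)
  have "csq \<theta> * \<theta>\<^sup>2 * Q 0 = csq \<theta> * (1 + (\<theta> * \<phi> $ 1)\<^sup>2) - (\<theta> * \<phi> $ 1)\<^sup>2"
    using c \<theta> by (simp add: Q_def field_simps power2_eq_square)
  also have "\<dots> \<ge> 0"
    using assms(2) by (simp add: \<theta>_def)
  finally have Q0: "Q 0 \<ge> 0"
    using mult_pos_neg[of "csq \<theta> * \<theta>\<^sup>2" "Q 0"] c(1) \<theta> by fastforce
  have cont: "continuous_on S Q" for S
    unfolding Q_def by (intro continuous_intros) (use \<theta> in auto)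
  obtain l where "l \<le> 0" "Q l = 0"
    using IVT'[of Q "-1" 0 0] Q1[of "-1"] Q0 cont by auto
  then show "\<exists>\<mu>\<le>0. poly (char_polynomial p \<phi>) \<mu> = 0"
    using char_polynomial_acoustic_root[OF assms(1), of l] by (auto simp: Q_def \<theta>_def)
  obtain r where "r \<ge> 0" "Q r = 0"
    using IVT2'[of Q 1 0 0] Q1[of 1] Q0 cont by auto
  then show "\<exists>\<mu>\<ge>0. poly (char_polynomial p \<phi>) \<mu> = 0"
    using char_polynomial_acoustic_root[OF assms(1), of r] by (auto simp: Q_def \<theta>_def)
qed

lemma char_speeds_root:
  assumes "char_speeds p \<phi> l1 l2 l3 l4" "poly (char_polynomial p \<phi>) \<mu> = 0"
  shows "\<mu> \<in> {l1, l2, l3, l4}"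
proof -
  have "{x. poly (char_polynomial p \<phi>) x = 0} = set_mset {#l1, l2, l3, l4#}"
    using assms(1) unfolding char_speeds_def by (metis set_count_proots)
  then show ?thesis
    using assms(2) by auto
qed

text \<open>Every root of the polynomial is one of the speeds. The contact root
  \<open>\<phi> $ 1 / \<phi> $ 0\<close> therefore fixes the sign of the normal velocity, and a flow
  that is not supersonic would contribute an acoustic root \<open>\<le> 0\<close>.\<close>

lemma char_speeds_positive:
  assumes "\<phi> \<in> states" "char_speeds p \<phi> l1 l2 l3 l4" "0 < l1" "0 < l2" "0 < l3" "0 < l4"
  shows "\<phi> $ 1 > 0"
    "(temp \<phi> * \<phi> $ 1)\<^sup>2 > csq (temp \<phi>) * (1 + (temp \<phi> * \<phi> $ 1)\<^sup>2)"
proof -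
  have pos: "\<mu> > 0" if "poly (char_polynomial p \<phi>) \<mu> = 0" for \<mu>
    using char_speeds_root[OF assms(2) that] assms(3-) by auto
  show "\<phi> $ 1 > 0"
    using pos[OF char_polynomial_contact_root[OF assms(1)]] assms(1)
    by (simp add: states_def zero_less_divide_iff)
  show "(temp \<phi> * \<phi> $ 1)\<^sup>2 > csq (temp \<phi>) * (1 + (temp \<phi> * \<phi> $ 1)\<^sup>2)"
    using not_supersonic_acoustic_roots(1)[OF assms(1)] pos by (meson not_le)
qed

lemma char_speeds_negative:
  assumes "\<phi> \<in> states" "char_speeds p \<phi> l1 l2 l3 l4" "l1 < 0" "l2 < 0" "l3 < 0" "l4 < 0"
  shows "\<phi> $ 1 < 0"
    "(temp \<phi> * \<phi> $ 1)\<^sup>2 > csq (temp \<phi>) * (1 + (temp \<phi> * \<phi> $ 1)\<^sup>2)"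
proof -
  have neg: "\<mu> < 0" if "poly (char_polynomial p \<phi>) \<mu> = 0" for \<mu>
    using char_speeds_root[OF assms(2) that] assms(3-) by auto
  show "\<phi> $ 1 < 0"
    using neg[OF char_polynomial_contact_root[OF assms(1)]] assms(1)
    by (simp add: states_def divide_less_0_iff)
  show "(temp \<phi> * \<phi> $ 1)\<^sup>2 > csq (temp \<phi>) * (1 + (temp \<phi> * \<phi> $ 1)\<^sup>2)"
    using not_supersonic_acoustic_roots(2)[OF assms(1)] neg by (meson not_le)
qed

end

section \<open>Change of inertial frame\<close>

lemma mprod_eq_inner: "mprod x y = x \<bullet> (mink *v y)"
  by (simp add: mprod_expand inner_vec_def sum_UNIV_4 mink_mult_component)

lemma orthochronous_mprod:
  assumes "orthochronous L"
  shows "mprod (L *v x) (L *v y) = mprod x y"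
proof -
  have "mprod (L *v x) (L *v y) = x \<bullet> (transpose L *v (mink *v (L *v y)))"
    unfolding mprod_eq_inner by (metis dot_lmul_matrix inner_commute transpose_matrix_vector)
  also have "\<dots> = x \<bullet> ((transpose L ** mink ** L) *v y)"
    by (simp add: matrix_vector_mul_assoc matrix_mul_assoc del: transpose_matrix_vector)
  finally show ?thesis
    using assms by (simp add: orthochronous_def mprod_eq_inner)
qed

lemma orthochronous_temp: "orthochronous L \<Longrightarrow> temp (L *v \<psi>) = temp \<psi>"
  by (simp add: temp_def orthochronous_mprod)

lemma mink_mink: "mink ** mink = mat 1"
proof -
  have "(mink ** mink) *v x = mat 1 *v x" for x
    by (simp add: matrix_vector_mul_assoc[symmetric] mink_mult_mink_mult)
  then show ?thesis
    by (simp add: matrix_eq)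
qed

text \<open>The time component of \<open>L *v \<psi>\<close> is \<open>- mprod y \<psi>\<close>,
  where \<open>y\<close> is the vector that \<open>L\<close> maps to the time axis. It is obtained
  from row \<open>0\<close> of \<open>L\<close>, so its square needs the Lorentz condition for
  \<open>transpose L\<close>, which follows because a left inverse of a square matrix is a right
  inverse.\<close>

lemma orthochronous_states:
  assumes "orthochronous L" "\<psi> \<in> states"
  shows "L *v \<psi> \<in> states"
proof -
  have "(mink ** transpose L ** mink) ** L = mat 1"
    using assms(1) by (simp add: orthochronous_def matrix_mul_assoc[symmetric] mink_mink)
  then have "L ** (mink ** transpose L ** mink) = mat 1"
    using matrix_left_right_inverse by blast
  then have "L ** mink ** transpose L ** (mink ** mink) = mink"
    by (metis matrix_mul_assoc matrix_mul_lid)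
  then have LmL: "L ** mink ** transpose L = mink"
    by (simp add: mink_mink)
  define y where "y = - (mink *v (L $ 0))"
  have "mprod y y = (L ** mink ** transpose L) $ 0 $ 0"
    by (simp add: y_def mprod_expand matrix_matrix_mult_def transpose_def sum_UNIV_4
        mink_mult_component mink_component)
  then have "mprod y y = - 1"
    by (simp add: LmL mink_component)
  moreover have "y $ 0 > 0"
    using assms(1) by (simp add: y_def mink_mult_component orthochronous_def)
  ultimately have "mprod y \<psi> < 0"
    using mprod_timelike_neg[of y \<psi>] assms(2) by (simp add: states_def)
  moreover have "(L *v \<psi>) $ 0 = - mprod y \<psi>"
    unfolding matrix_vector_mult_def[of L]
    by (simp add: y_def mprod_expand sum_UNIV_4 mink_mult_component)
  ultimately show ?thesis
    using assms by (simp add: states_def orthochronous_mprod)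
qed

context causal_fluid
begin

text \<open>The supersonic end \<open>s\<close> is the reference: \<open>N\<close>,
  \<open>q0\<close> and \<open>q1\<close> are read off from it, and the Rankine-Hugoniot conditions
  carry the flux vector over to the other end. The hypotheses on \<open>v\<close> say that the fluid
  enters the shock from the side of \<open>s\<close>.\<close>

lemma supersonic_shock_profile:
  assumes "genuinely_nonlinear p"
    and visc: "smooth_on states \<eta>" "\<And>\<psi>. \<psi> \<in> states \<Longrightarrow> \<eta> \<psi> > 0"
      "smooth_on states \<zeta>" "\<And>\<psi>. \<psi> \<in> states \<Longrightarrow> \<zeta> \<psi> > 0"
    and shock: "shock p \<psi>m \<psi>p \<xi>"
    and s: "s \<in> {\<psi>m, \<psi>p}" "v = mprod (mink *v \<xi>) (velocity s)"
    and dir: "v \<noteq> 0" "s = \<psi>m \<longleftrightarrow> v > 0"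
    and supersonic: "v\<^sup>2 > csq (temp s) * (1 + v\<^sup>2)"
  shows "\<exists>\<Psi>. dissipation_profile p \<eta> \<zeta> (\<lambda>\<psi>. 0) \<psi>m \<psi>p \<xi> \<Psi>"
proof -
  define r where "r = sqrt (1 + v\<^sup>2)"
  define N where "N = (1 / r) *\<^sub>R (velocity s - v *\<^sub>R (mink *v \<xi>))"
  define q0 where "q0 = temp s * deriv p (temp s) * v * r"
  define q1 where "q1 = temp s * deriv p (temp s) * v\<^sup>2 + p (temp s)"
  have states: "s \<in> states" "\<psi>m \<in> states" "\<psi>p \<in> states" and \<xi>\<xi>: "mprod \<xi> \<xi> = 1"
    and ne: "\<psi>m \<noteq> \<psi>p" and RH: "\<And>\<alpha>. normal_flux p \<xi> \<psi>m \<alpha> = normal_flux p \<xi> \<psi>p \<alpha>"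
    using shock s(1) by (auto simp: shock_def)
  have r: "r > 0" "r * r = 1 + v\<^sup>2"
    by (auto simp: r_def add_pos_nonneg)
  have w: "temp s * deriv p (temp s) > 0"
    using temp_pos[OF states(1)] p'_pos by simp
  have XX: "mprod (mink *v \<xi>) (mink *v \<xi>) = 1"
    by (simp add: mprod_mink_mult \<xi>\<xi>)
  have UX: "mprod (velocity s) (mink *v \<xi>) = v"
    by (simp add: s(2) mprod_commute)
  note UU = mprod_velocity[OF states(1)]
  have rN: "velocity s - v *\<^sub>R (mink *v \<xi>) = r *\<^sub>R N"
    using r by (simp add: N_def)
  have "mprod (r *\<^sub>R N) (r *\<^sub>R N) = - (r * r)"
    unfolding rN[symmetric] r(2) by (simp add: mprod_linear UU XX UX s(2)[symmetric] power2_eq_square)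
  then have "(r * r) * mprod N N = (r * r) * (- 1)"
    by (simp add: mprod_linear)
  then have NN: "mprod N N = - 1"
    using r(1) unfolding mult_cancel_left by simp
  have "mprod (velocity s) (r *\<^sub>R N) = - (r * r)"
    unfolding rN[symmetric] r(2) by (simp add: mprod_linear UU UX power2_eq_square)
  then have "r * mprod (velocity s) N < 0"
    using r(1) by (simp add: mprod_linear)
  then have "mprod (velocity s) N < 0"
    using r(1) by (simp add: mult_less_0_iff)
  then have N0: "N $ 0 > 0"
    using timelike_future[of "velocity s" N] velocity_future[OF states(1)] UU NN by simp
  have NX: "mprod N (mink *v \<xi>) = 0"
    unfolding N_def by (simp add: mprod_linear UX XX)
  have q0: "q0 \<noteq> 0"
    using w r(1) dir(1) by (metis mult_eq_0_iff less_irrefl q0_def)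
  interpret shock_flux p \<xi> N q0 q1
    by unfold_locales (use assms(1) \<xi>\<xi> NN N0 NX q0 in auto)
  have "normal_flux p \<xi> s \<alpha> = (q0 *\<^sub>R N + q1 *\<^sub>R X) $ \<alpha>" for \<alpha>
  proof -
    have U: "velocity s = r *\<^sub>R N + v *\<^sub>R X"
      using rN by (simp add: algebra_simps)
    show ?thesis
      unfolding normal_flux_eq s(2)[symmetric] unfolding U
      by (simp add: q0_def q1_def power2_eq_square algebra_simps)
  qed
  then have flux: "normal_flux p \<xi> \<psi>m \<alpha> = (q0 *\<^sub>R N + q1 *\<^sub>R X) $ \<alpha>"
    "normal_flux p \<xi> \<psi>p \<alpha> = (q0 *\<^sub>R N + q1 *\<^sub>R X) $ \<alpha>" for \<alpha>
    using s(1) RH by auto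
  note m = state_on_profile[OF states(2) flux(1)] and p = state_on_profile[OF states(3) flux(2)]
  have "v * q0 = (temp s * deriv p (temp s)) * r * v\<^sup>2"
    by (simp add: q0_def power2_eq_square)
  then have "v * q0 > 0"
    using mult_pos_pos[OF mult_pos_pos[OF w r(1)], of "v\<^sup>2"] dir(1) by simp
  have "E (temp s) = temp s * deriv p (temp s) * (v\<^sup>2 - csq (temp s) * (1 + v\<^sup>2))"
    using s m(5) p(5) by auto
  then have sup: "E (temp s) > 0"
    using mult_pos_pos[OF w] supersonic by simp
  have temps: "temp \<psi>m \<noteq> temp \<psi>p"
    using m(3) p(3) ne by metis
  show ?thesis
  proof (cases "s = \<psi>m")
    case True
    then have "q0 > 0"
      using dir(2) \<open>v * q0 > 0\<close> by (simp add: zero_less_mult_iff)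
    \<comment> \<open>Otherwise \<open>temp \<psi>m\<close> would be the right one of two zeros of
      \<open>H\<close>, where \<open>E\<close> cannot be positive.\<close>
    moreover have "temp \<psi>m < temp \<psi>p"
      using E_nonpos_at_right_zero[OF dom_pos[OF p(1)] _ p(2) m(2)] sup True temps by fastforce
    ultimately show ?thesis
      using profile_exists[OF visc m(1) _ m(2) p(2)] by (simp add: m(3) p(3))
  next
    case False
    then have "s = \<psi>p" "\<not> q0 > 0"
      using s(1) dir \<open>v * q0 > 0\<close> by (auto simp: zero_less_mult_iff)
    moreover have "temp \<psi>p < temp \<psi>m"
      using E_nonpos_at_right_zero[OF dom_pos[OF m(1)] _ m(2) p(2)] sup \<open>s = \<psi>p\<close> temps by fastforce
    ultimately show ?thesis
      using profile_exists[OF visc p(1) _ p(2) m(2)] by (simp add: m(3) p(3))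
  qed
qed

end

theorem theorem1:
  fixes p :: "real \<Rightarrow> real" and \<eta> \<zeta> :: "real^4 \<Rightarrow> real" and \<psi>m \<psi>p \<xi> :: "real^4"
  assumes "smooth_on {0<..} p"
    and "strictly_causal p"
    and "smooth_on states \<eta>" and "\<forall>\<psi>\<in>states. \<eta> \<psi> > 0"
    and "smooth_on states \<zeta>" and "\<forall>\<psi>\<in>states. \<zeta> \<psi> > 0"
    and "genuinely_nonlinear p"
    and "lax_shock p \<psi>m \<psi>p \<xi>"
  shows "\<exists>\<Psi>. dissipation_profile p \<eta> \<zeta> (\<lambda>\<psi>. 0) \<psi>m \<psi>p \<xi> \<Psi>"
proof -
  interpret causal_fluid p
    using assms(1,2) by unfold_locales
  obtain L l1 l2 l3 l4 m1 m2 m3 m4 where shock: "shock p \<psi>m \<psi>p \<xi>"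
    and L: "orthochronous L" "axis 1 1 v* L = \<xi>"
    and speeds: "char_speeds p (L *v \<psi>m) l1 l2 l3 l4" "char_speeds p (L *v \<psi>p) m1 m2 m3 m4"
    and lax: "(0 < l1 \<and> 0 < l2 \<and> 0 < l3 \<and> 0 < l4) \<or> (m1 < 0 \<and> m2 < 0 \<and> m3 < 0 \<and> m4 < 0)"
    using assms(8) unfolding lax_shock_def by blast
  have st: "L *v \<psi>m \<in> states" "L *v \<psi>p \<in> states"
    using shock orthochronous_states[OF L(1)] by (auto simp: shock_def)
  \<comment> \<open>Pairing with \<open>\<xi>\<close> reads off component \<open>1\<close> in the
    frame in which the characteristic speeds are given.\<close>
  have normal: "mprod (mink *v \<xi>) (velocity \<psi>) = temp (L *v \<psi>) * (L *v \<psi>) $ 1" for \<psi>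
  proof -
    have "mprod (mink *v \<xi>) (velocity \<psi>) = axis 1 1 \<bullet> (L *v velocity \<psi>)"
      unfolding mprod_mink_mult_left L(2)[symmetric] by (simp add: inner_vec_def[symmetric] dot_lmul_matrix flip: inner_real_def)
    then show ?thesis
      by (simp add: inner_axis' velocity_def orthochronous_temp[OF L(1)] matrix_vector_mult_scaleR)
  qed
  note profile = supersonic_shock_profile[OF assms(7,3) _ assms(5) _ shock _ normal[symmetric]]
  \<comment> \<open>In either case the state whose speeds all have one sign is the supersonic one:
    \<open>\<psi>m\<close> with positive or \<open>\<psi>p\<close> with negative normal
    velocity.\<close>
  from lax show ?thesis
  proof
    assume l: "0 < l1 \<and> 0 < l2 \<and> 0 < l3 \<and> 0 < l4"
    note sp = char_speeds_positive[OF st(1) speeds(1)]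
    have "temp (L *v \<psi>m) * (L *v \<psi>m) $ 1 > 0"
      using sp(1) l temp_pos[OF st(1)] by simp
    then show ?thesis
      using sp(2) l assms(4,6) by (intro profile[of \<psi>m]) (auto simp: orthochronous_temp[OF L(1)])
  next
    assume l: "m1 < 0 \<and> m2 < 0 \<and> m3 < 0 \<and> m4 < 0"
    note sp = char_speeds_negative[OF st(2) speeds(2)]
    have "temp (L *v \<psi>p) * (L *v \<psi>p) $ 1 < 0"
      using sp(1) l temp_pos[OF st(2)] by (simp add: mult_pos_neg)
    moreover have "\<psi>p \<noteq> \<psi>m"
      using shock by (auto simp: shock_def)
    ultimately show ?thesis
      using sp(2) l assms(4,6) by (intro profile[of \<psi>p]) (auto simp: orthochronous_temp[OF L(1)])
  qed
qed

end
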